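(* For all integers $g\geq 0$, $p\geq 1$ and $k\geq 2$, there is an integer $n\geq\frac14 k\sqrt{p+g}$ such that $K_n$ is a minor of some $(g,p,k)$-almost embeddable graph.
   Context: All graphs are finite and simple. Vortices: Let $\Omega=(v_1,\dots,v_t)$ be a circular ordering of a subset $V(\Omega)$ of the vertices of a graph $G$. A circular decomposition of $G$ with perimeter $\Omega$ is a multiset $\{C\langle w\rangle\subseteq V(G): w\in V(\Omega)\}$ of bags such that: each $w\in V(\Omega)$ lies in $C\langle w\rangle$; each vertex of $G$ lies in some bag; for each edge some bag contains both endpoints; and for each vertex $u$, the set of $w$ with $u\in C\langle w\rangle$ forms a set of cyclically consecutive elements of $\Omega$. Its width is the maximum bag size minus 1; the vortex $(G,\Omega)$ has width equal to the minimum width of such a decomposition. A graph $G$ is $(g,p,k)$-almost embeddable if there exist a graph $G_0$ embedded in a surface $\Sigma$ of Euler genus at most $g$ and $q\leq p$ vortices $(G_1,\Omega_1),\dots,(G_q,\Omega_q)$ of width at most $k$ with $G=G_0\cup\dots\cup G_q$; $G_1,\dots,G_q$ pairwise vertex-disjoint; $V(G_i)\cap V(G_0)=V(\Omega_i)$; and $q$ pairwise disjoint closed discs in $\Sigma$ with interiors $D_1,\dots,D_q$ disjoint from $G_0$, boundaries meeting $G_0$ only in vertices, $\partial D_i\cap V(G_0)=V(\Omega_i)$, and $\Omega_i$ compatible with the cyclic order along $\partial D_i$. *)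

theory Defs
  imports "HOL-Analysis.Analysis"
begin

section \<open>Finite simple graphs and minors\<close>

datatype 'v ugraph = UGraph (verts: "'v set") (edges: "'v set set")

definition simple_graph :: "'v ugraph \<Rightarrow> bool" where
  "simple_graph G \<longleftrightarrow> finite (verts G) \<and> (\<forall>e\<in>edges G. e \<subseteq> verts G \<and> card e = 2)"

definition complete_graph :: "nat \<Rightarrow> nat ugraph" where
  "complete_graph n = UGraph {..<n} {e. e \<subseteq> {..<n} \<and> card e = 2}"

definition connected_in :: "'v ugraph \<Rightarrow> 'v set \<Rightarrow> bool" where
  "connected_in G S \<longleftrightarrow> S \<noteq> {} \<and> S \<subseteq> verts G \<and>
     (\<forall>x\<in>S. \<forall>y\<in>S. (x, y) \<in> {(u, v). u \<in> S \<and> v \<in> S \<and> {u, v} \<in> edges G}\<^sup>*)"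

text \<open>\<open>B x\<close> is the branch set that is contracted to the vertex \<open>x\<close> of \<open>H\<close>.\<close>

definition is_minor :: "'a ugraph \<Rightarrow> 'v ugraph \<Rightarrow> bool" where
  "is_minor H G \<longleftrightarrow> (\<exists>B :: 'a \<Rightarrow> 'v set.
     (\<forall>x\<in>verts H. connected_in G (B x)) \<and>
     disjoint_family_on B (verts H) \<and>
     (\<forall>x y. {x, y} \<in> edges H \<longrightarrow> (\<exists>u\<in>B x. \<exists>v\<in>B y. {u, v} \<in> edges G)))"


section \<open>Vortices\<close>

text \<open>A circular ordering is a distinct list, read cyclically.\<close>

definition cyclically_consecutive :: "'v list \<Rightarrow> 'v set \<Rightarrow> bool" where
  "cyclically_consecutive \<Omega> S \<longleftrightarrow> (\<exists>s l. S = (\<lambda>i. \<Omega> ! ((s + i) mod length \<Omega>)) ` {..<l})"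

definition vortex :: "'v ugraph \<Rightarrow> 'v list \<Rightarrow> bool" where
  "vortex G \<Omega> \<longleftrightarrow> simple_graph G \<and> distinct \<Omega> \<and> \<Omega> \<noteq> [] \<and> set \<Omega> \<subseteq> verts G"

definition circular_decomposition :: "'v ugraph \<Rightarrow> 'v list \<Rightarrow> ('v \<Rightarrow> 'v set) \<Rightarrow> bool" where
  "circular_decomposition G \<Omega> C \<longleftrightarrow>
     (\<forall>w\<in>set \<Omega>. C w \<subseteq> verts G \<and> w \<in> C w) \<and>
     (\<forall>u\<in>verts G. \<exists>w\<in>set \<Omega>. u \<in> C w) \<and>
     (\<forall>e\<in>edges G. \<exists>w\<in>set \<Omega>. e \<subseteq> C w) \<and>
     (\<forall>u\<in>verts G. cyclically_consecutive \<Omega> {w\<in>set \<Omega>. u \<in> C w})"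

definition decomposition_width :: "'v list \<Rightarrow> ('v \<Rightarrow> 'v set) \<Rightarrow> nat" where
  "decomposition_width \<Omega> C = Max ((\<lambda>w. card (C w)) ` set \<Omega>) - 1"

text \<open>The minimum exists for every vortex: taking all vertices as every bag is a decomposition.\<close>

definition vortex_width :: "'v ugraph \<Rightarrow> 'v list \<Rightarrow> nat" where
  "vortex_width G \<Omega> =
     (LEAST m. \<exists>C. circular_decomposition G \<Omega> C \<and> m = decomposition_width \<Omega> C)"


section \<open>Surfaces\<close>

text \<open>
  By the classification theorem, the surfaces (compact connected 2-manifolds without boundary)
  are the spheres with \<open>h\<close> handles and \<open>c\<close> crosscaps added, and such a surface has
  Euler genus \<open>2 * h + c\<close>. The sphere is the one-point compactification of the
  plane. Pairwise disjoint round open discs with indices \<open>j < 2 * h + c\<close>, centres \<open>a j\<close> and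
  radii \<open>r j\<close> are removed from it. For \<open>i < h\<close> the boundary circles \<open>2 * i\<close> and \<open>2 * i + 1\<close> are
  identified by a reflection, which attaches an untwisted handle, and in each of the
  last \<open>c\<close> circles antipodal points are identified, which attaches a crosscap.
  The homeomorphism type does not depend on the choice of the discs.
\<close>

definition sphere_space :: "complex option topology" where
  "sphere_space = Alexandroff_compactification euclidean"

definition holed_sphere :: "nat \<Rightarrow> (nat \<Rightarrow> complex) \<Rightarrow> (nat \<Rightarrow> real) \<Rightarrow> complex option set" where
  "holed_sphere m a r = topspace sphere_space - Some ` (\<Union>j<m. ball (a j) (r j))"

definition glued ::
    "nat \<Rightarrow> nat \<Rightarrow> (nat \<Rightarrow> complex) \<Rightarrow> (nat \<Rightarrow> real) \<Rightarrow> complex option \<Rightarrow> complex option \<Rightarrow> bool" where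
  "glued h c a r x y \<longleftrightarrow> (\<exists>z. cmod z = 1 \<and>
     ((\<exists>i<h. x = Some (a (2*i) + of_real (r (2*i)) * z) \<and>
             y = Some (a (2*i+1) + of_real (r (2*i+1)) * cnj z)) \<or>
      (\<exists>j\<in>{2*h..<2*h+c}. x = Some (a j + of_real (r j) * z) \<and>
                          y = Some (a j - of_real (r j) * z))))"

definition surface_of_Euler_genus :: "'s topology \<Rightarrow> nat \<Rightarrow> bool" where
  "surface_of_Euler_genus S e \<longleftrightarrow> (\<exists>h c a r \<pi>.
     e = 2 * h + c \<and>
     (\<forall>j<2*h+c. 0 < r j) \<and>
     disjoint_family_on (\<lambda>j. cball (a j) (r j)) {..<2*h+c} \<and>
     quotient_map (subtopology sphere_space (holed_sphere (2*h+c) a r)) S \<pi> \<and>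
     (\<forall>x\<in>holed_sphere (2*h+c) a r. \<forall>y\<in>holed_sphere (2*h+c) a r.
        \<pi> x = \<pi> y \<longleftrightarrow> x = y \<or> glued h c a r x y \<or> glued h c a r y x))"


section \<open>Embedded graphs and discs\<close>

definition graph_embedding ::
    "'v ugraph \<Rightarrow> 's topology \<Rightarrow> ('v \<Rightarrow> 's) \<Rightarrow> ('v set \<Rightarrow> real \<Rightarrow> 's) \<Rightarrow> bool" where
  "graph_embedding G S \<phi> \<gamma> \<longleftrightarrow>
     \<phi> ` verts G \<subseteq> topspace S \<and> inj_on \<phi> (verts G) \<and>
     (\<forall>e\<in>edges G. embedding_map (top_of_set {0..1}) S (\<gamma> e) \<and>
        {\<gamma> e 0, \<gamma> e 1} = \<phi> ` e \<and>
        \<gamma> e ` {0<..<1} \<inter> \<phi> ` verts G = {}) \<and>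
     disjoint_family_on (\<lambda>e. \<gamma> e ` {0<..<1}) (edges G)"

definition embedded_points ::
    "'v ugraph \<Rightarrow> ('v \<Rightarrow> 's) \<Rightarrow> ('v set \<Rightarrow> real \<Rightarrow> 's) \<Rightarrow> 's set" where
  "embedded_points G \<phi> \<gamma> = \<phi> ` verts G \<union> (\<Union>e\<in>edges G. \<gamma> e ` {0..1})"

text \<open>
  A closed disc in \<open>S\<close> is given by an embedding \<open>\<delta>\<close> of the closed unit disc; its interior and
  boundary are the images of the open disc and the unit circle. Replacing \<open>\<delta>\<close> by \<open>\<delta> \<circ> cnj\<close>
  reverses the direction in which the boundary is traversed, so fixing the direction of increasing
  angles below is no restriction.
\<close>

definition vortex_disc ::
    "'v ugraph \<Rightarrow> 's topology \<Rightarrow> ('v \<Rightarrow> 's) \<Rightarrow> ('v set \<Rightarrow> real \<Rightarrow> 's) \<Rightarrow> 'v list \<Rightarrow> (complex \<Rightarrow> 's) \<Rightarrow> bool"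
  where
  "vortex_disc G S \<phi> \<gamma> \<Omega> \<delta> \<longleftrightarrow>
     embedding_map (top_of_set (cball 0 1)) S \<delta> \<and>
     \<delta> ` ball 0 1 \<inter> embedded_points G \<phi> \<gamma> = {} \<and>
     \<delta> ` sphere 0 1 \<inter> embedded_points G \<phi> \<gamma> \<subseteq> \<phi> ` verts G \<and>
     \<delta> ` sphere 0 1 \<inter> \<phi> ` verts G = \<phi> ` set \<Omega> \<and>
     (\<exists>\<theta> :: nat \<Rightarrow> real. strict_mono_on {..<length \<Omega>} \<theta> \<and>
        (\<forall>j<length \<Omega>. \<theta> j < \<theta> 0 + 2 * pi \<and> \<phi> (\<Omega> ! j) = \<delta> (cis (\<theta> j))))"


section \<open>Almost embeddable graphs\<close>

text \<open>
  The type of points of the surface is fixed because types cannot be quantified. This is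
  no restriction: points can be taken to be the equivalence classes of the gluing.
\<close>

definition almost_embeddable :: "nat \<Rightarrow> nat \<Rightarrow> nat \<Rightarrow> 'v ugraph \<Rightarrow> bool" where
  "almost_embeddable g p k G \<longleftrightarrow>
     (\<exists>(S :: complex option set topology) e G0 \<phi> \<gamma> q Gs \<Omega> \<delta>.
        surface_of_Euler_genus S e \<and> e \<le> g \<and>
        simple_graph G0 \<and> graph_embedding G0 S \<phi> \<gamma> \<and>
        q \<le> p \<and>
        (\<forall>i<q. vortex (Gs i) (\<Omega> i) \<and> vortex_width (Gs i) (\<Omega> i) \<le> k) \<and>
        G = UGraph (verts G0 \<union> (\<Union>i<q. verts (Gs i))) (edges G0 \<union> (\<Union>i<q. edges (Gs i))) \<and>
        disjoint_family_on (\<lambda>i. verts (Gs i)) {..<q} \<and>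
        (\<forall>i<q. verts (Gs i) \<inter> verts G0 = set (\<Omega> i)) \<and>
        (\<forall>i<q. vortex_disc G0 S \<phi> \<gamma> (\<Omega> i) (\<delta> i)) \<and>
        disjoint_family_on (\<lambda>i. \<delta> i ` cball 0 1) {..<q})"

end

theory Submission
  imports Defs
begin

text \<open>A vortex of width \<open>k\<close> simulates \<open>k\<close> pairwise adjacent hub vertices on every interval of its boundary:
  all hubs of the interval belong to all of its bags, and every boundary vertex is attached to one of them.

  If \<open>g\<close> is not much smaller than \<open>p\<close>, one vortex suffices. Its boundary is divided into \<open>m\<close> intervals with
  \<open>m (m - 1) \<le> g\<close>. For every pair of intervals a handle carries \<open>k\<^sup>2\<close> disjoint edges, one for every pair of hubs,
  so that contracting these edges onto the hubs gives a complete minor with \<open>m k\<close> vertices.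

  Otherwise the sphere is used, with an \<open>L\<close> by \<open>L\<close> grid of vortices, \<open>L\<^sup>2 \<le> p\<close>. For \<open>t = k div 2\<close>, every row and every
  column consists of \<open>t\<close> parallel strands running through the hubs. As each vortex makes its row strands adjacent to its
  column strands, the \<open>L t\<close> unions of a row strand and the corresponding column strand are the branch sets of a complete minor.\<close>

section \<open>Spheres with handles\<close>

text \<open>Handles and vortices are used separately because the larger of \<open>p\<close> and
  \<open>g\<close> is at least half of \<open>p + g\<close>: serving only one resource costs a
  constant factor, and 1/4 leaves room for it. The single vortex yields about
  \<open>k * sqrt g\<close>: a handle has Euler genus 2, so one handle for each of the
  \<open>m * (m - 1) div 2\<close> pairs of intervals costs \<open>m * (m - 1)\<close>. The grid
  yields about \<open>(k div 2) * sqrt p\<close>, since the hubs of a vortex are shared between a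
  row and a column.

  The obstacle is topological: the surface is only a quotient of a sphere with round holes, and arcs
  and discs must be shown to be embedded in it. So an edge through a handle is subdivided by a
  vertex on the glued circles. Each half is then a straight segment in the plane that touches the
  closed holes at most in its end point, and away from the closed holes the projection to the
  surface is injective. Embeddings, crossings and discs thereby become statements about explicit
  coordinates.\<close>

lemma quotient_map_of_surjection:
  assumes "\<And>V. openin Y V \<longleftrightarrow> V \<subseteq> f ` topspace X \<and> openin X {x \<in> topspace X. f x \<in> V}"
  shows "quotient_map X Y f"
proof -
  have "{x \<in> topspace X. f x \<in> f ` topspace X} = topspace X"
    by auto
  then have "openin Y (f ` topspace X)"
    by (simp add: assms)
  then have "topspace Y = f ` topspace X"
    using assms by (meson openin_subset openin_topspace subset_antisym)
  then show ?thesis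
    unfolding quotient_map_def using assms by auto
qed

text \<open>The final topology makes every map a quotient map onto its image. It turns the set of
  glued classes into a space.\<close>

lemma exists_quotient_map: "\<exists>Y. quotient_map X Y f"
proof -
  define op where "op V \<longleftrightarrow> V \<subseteq> f ` topspace X \<and> openin X {x \<in> topspace X. f x \<in> V}" for V
  have "istopology op"
    unfolding istopology_def
  proof (intro conjI allI impI)
    fix V W assume "op V" "op W"
    moreover have "{x \<in> topspace X. f x \<in> V \<inter> W} =
        {x \<in> topspace X. f x \<in> V} \<inter> {x \<in> topspace X. f x \<in> W}"
      by auto
    ultimately show "op (V \<inter> W)"
      unfolding op_def by auto
  next
    fix \<V> assume "\<forall>V\<in>\<V>. op V"
    moreover have "{x \<in> topspace X. f x \<in> \<Union>\<V>} = (\<Union>V\<in>\<V>. {x \<in> topspace X. f x \<in> V})"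
      by auto
    ultimately show "op (\<Union>\<V>)"
      unfolding op_def by auto
  qed
  then have "openin (topology op) = op"
    by (rule topology_inverse')
  then show ?thesis
    by (intro exI[of _ "topology op"] quotient_map_of_surjection) (simp add: op_def)
qed

text \<open>A handle joins two holes at different places, which is how an edge gets from one
  interval to another. Crosscaps are left out, so the Euler genus is \<open>2 * h\<close>.\<close>

locale handles =
  fixes h :: nat and a :: "nat \<Rightarrow> complex" and r :: "nat \<Rightarrow> real"
  assumes radius_pos: "j < 2 * h \<Longrightarrow> 0 < r j"
    and disjoint_holes: "disjoint_family_on (\<lambda>j. cball (a j) (r j)) {..<2 * h}"
begin

text \<open>The gluing of \<open>a i + r i * z\<close> with \<open>a j + r j * cnj z\<close>, with
  \<open>z\<close> eliminated. As a map of the whole plane it is continuous everywhere, and for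
  positive radii \<open>mirror j i\<close> inverts it.\<close>

definition mirror :: "nat \<Rightarrow> nat \<Rightarrow> complex \<Rightarrow> complex" where
  "mirror i j w = a j + of_real (r j) * cnj ((w - a i) / of_real (r i))"

definition twins :: "complex \<Rightarrow> complex \<Rightarrow> bool" where
  "twins w w' \<longleftrightarrow> (\<exists>i<h. w \<in> sphere (a (2*i)) (r (2*i)) \<and> w' = mirror (2*i) (2*i+1) w)"

definition holes :: "complex set" where
  "holes = (\<Union>j<2*h. ball (a j) (r j))"

definition closed_holes :: "complex set" where
  "closed_holes = (\<Union>j<2*h. cball (a j) (r j))"

lemma holes_subset: "holes \<subseteq> closed_holes"
  unfolding holes_def closed_holes_def by force

lemma hole_unique:
  assumes "w \<in> cball (a i) (r i)" "w \<in> cball (a j) (r j)" "i < 2*h" "j < 2*h"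
  shows "i = j"
  using disjoint_holes assms unfolding disjoint_family_on_def by blast

lemma mirror_mirror:
  assumes "i < 2*h" "j < 2*h"
  shows "mirror j i (mirror i j w) = w"
  using radius_pos[OF assms(1)] radius_pos[OF assms(2)] by (simp add: mirror_def)

lemma mirror_sphere:
  assumes "i < 2*h" "j < 2*h" "w \<in> sphere (a i) (r i)"
  shows "mirror i j w \<in> sphere (a j) (r j)"
proof -
  have "dist (a j) (mirror i j w) = r j * (cmod (w - a i) / r i)"
    using radius_pos[OF assms(1)] radius_pos[OF assms(2)]
    by (simp add: mirror_def dist_norm norm_mult norm_divide flip: complex_cnj_diff)
  then show ?thesis
    using assms radius_pos[OF assms(1)] by (simp add: dist_norm norm_minus_commute)
qed

lemma continuous_mirror: "continuous_on A (mirror i j)"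
  unfolding mirror_def divide_inverse by (intro continuous_intros)

lemma twins_sphere:
  assumes "twins w w'"
  obtains i where "i < h" "w \<in> sphere (a (2*i)) (r (2*i))"
    "w' \<in> sphere (a (2*i+1)) (r (2*i+1))" "w' = mirror (2*i) (2*i+1) w"
    "w = mirror (2*i+1) (2*i) w'"
proof -
  obtain i where i: "i < h" "w \<in> sphere (a (2*i)) (r (2*i))" "w' = mirror (2*i) (2*i+1) w"
    using assms unfolding twins_def by blast
  have ij: "2*i < 2*h" "2*i+1 < 2*h"
    using i(1) by auto
  have "w' \<in> sphere (a (2*i+1)) (r (2*i+1))"
    unfolding i(3) by (rule mirror_sphere[OF ij i(2)])
  moreover have "w = mirror (2*i+1) (2*i) w'"
    unfolding i(3) by (rule mirror_mirror[OF ij, symmetric])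
  ultimately show ?thesis
    by (rule that[OF i(1,2) _ i(3)])
qed

lemma glued_iff_twins: "glued h 0 a r x y \<longleftrightarrow> (\<exists>w w'. x = Some w \<and> y = Some w' \<and> twins w w')"
proof
  assume "glued h 0 a r x y"
  then obtain z i where z: "cmod z = 1" "i < h"
      "x = Some (a (2*i) + of_real (r (2*i)) * z)"
      "y = Some (a (2*i+1) + of_real (r (2*i+1)) * cnj z)"
    unfolding glued_def by auto
  have "0 < r (2*i)"
    using z(2) radius_pos by simp
  then have "twins (a (2*i) + of_real (r (2*i)) * z) (a (2*i+1) + of_real (r (2*i+1)) * cnj z)"
    unfolding twins_def using z(1,2)
    by (intro exI[of _ i]) (auto simp: mirror_def dist_norm norm_mult)
  then show "\<exists>w w'. x = Some w \<and> y = Some w' \<and> twins w w'"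
    using z by blast
next
  assume "\<exists>w w'. x = Some w \<and> y = Some w' \<and> twins w w'"
  then obtain w i where w: "i < h" "w \<in> sphere (a (2*i)) (r (2*i))" "x = Some w"
      "y = Some (mirror (2*i) (2*i+1) w)"
    unfolding twins_def by blast
  have r: "0 < r (2*i)"
    using w radius_pos by simp
  define z where "z = (w - a (2*i)) / of_real (r (2*i))"
  have "cmod z = 1"
    using w r by (simp add: z_def norm_divide dist_norm norm_minus_commute)
  moreover have "x = Some (a (2*i) + of_real (r (2*i)) * z)"
    using w r by (simp add: z_def)
  moreover have "y = Some (a (2*i+1) + of_real (r (2*i+1)) * cnj z)"
    using w by (simp add: z_def mirror_def)
  ultimately show "glued h 0 a r x y"
    unfolding glued_def using w(1) by blast
qed

lemma twins_right_unique:
  assumes "twins w u" "twins w v"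
  shows "u = v"
proof -
  obtain i where i: "i < h" "w \<in> sphere (a (2*i)) (r (2*i))" "u = mirror (2*i) (2*i+1) w"
    using twins_sphere[OF assms(1)] by blast
  obtain j where j: "j < h" "w \<in> sphere (a (2*j)) (r (2*j))" "v = mirror (2*j) (2*j+1) w"
    using twins_sphere[OF assms(2)] by blast
  have "2*i = 2*j"
    by (rule hole_unique[of w]) (use i j in auto)
  with i j show ?thesis by simp
qed

lemma twins_left_unique:
  assumes "twins u w" "twins v w"
  shows "u = v"
proof -
  obtain i where i: "i < h" "w \<in> sphere (a (2*i+1)) (r (2*i+1))" "u = mirror (2*i+1) (2*i) w"
    using twins_sphere[OF assms(1)] by blast
  obtain j where j: "j < h" "w \<in> sphere (a (2*j+1)) (r (2*j+1))" "v = mirror (2*j+1) (2*j) w"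
    using twins_sphere[OF assms(2)] by blast
  have "2*i+1 = 2*j+1"
    by (rule hole_unique[of w]) (use i j in auto)
  with i j show ?thesis by simp
qed

text \<open>A target of the gluing lies on a circle of odd index and a source on one of even index,
  while disjointness of the closed discs makes the circle through a point unique.\<close>

lemma twins_not_chain: "twins u v \<Longrightarrow> \<not> twins v w"
proof
  assume uv: "twins u v" and vw: "twins v w"
  obtain i where i: "i < h" "v \<in> sphere (a (2*i+1)) (r (2*i+1))"
    using twins_sphere[OF uv] by blast
  obtain j where j: "j < h" "v \<in> sphere (a (2*j)) (r (2*j))"
    using twins_sphere[OF vw] by blast
  have "2*i+1 = 2*j"
    by (rule hole_unique[of v]) (use i j in auto)
  then show False by presburger
qed

lemma twins_closed_holes: "twins u v \<Longrightarrow> u \<in> closed_holes \<and> v \<in> closed_holes"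
proof -
  assume uv: "twins u v"
  obtain i where "i < h" "u \<in> sphere (a (2*i)) (r (2*i))" "v \<in> sphere (a (2*i+1)) (r (2*i+1))"
    using twins_sphere[OF uv] by blast
  moreover from this have "2*i < 2*h" "2*i+1 < 2*h" by auto
  ultimately show ?thesis
    unfolding closed_holes_def by (meson UN_I lessThan_iff sphere_cball subsetD)
qed

section \<open>The surface as a space of classes of glued points\<close>

definition point_class :: "complex option \<Rightarrow> complex option set" where
  "point_class x = {y. x = y \<or> glued h 0 a r x y \<or> glued h 0 a r y x}"

text \<open>Uniqueness of twins on both sides and the absence of chains make the class of a glued
  point exactly the pair of the two glued points, seen from either of them. So
  \<open>point_class\<close> really yields equivalence classes.\<close>

lemma point_class_eq_iff:
  "point_class x = point_class y \<longleftrightarrow> x = y \<or> glued h 0 a r x y \<or> glued h 0 a r y x"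
proof
  assume "point_class x = point_class y"
  then have "y \<in> point_class x"
    unfolding point_class_def by blast
  then show "x = y \<or> glued h 0 a r x y \<or> glued h 0 a r y x"
    unfolding point_class_def by blast
next
  have twin_classes: "point_class (Some w) = point_class (Some w')" if "twins w w'" for w w'
  proof -
    have "point_class (Some w) = {Some w, Some w'}"
      unfolding point_class_def glued_iff_twins
      using that by (auto dest: twins_right_unique[OF that] twins_not_chain)
    moreover have "point_class (Some w') = {Some w, Some w'}"
      unfolding point_class_def glued_iff_twins
      using that by (auto dest: twins_left_unique[OF that] twins_not_chain)
    ultimately show ?thesis by simp
  qed
  assume "x = y \<or> glued h 0 a r x y \<or> glued h 0 a r y x"
  then show "point_class x = point_class y"
    unfolding glued_iff_twins using twin_classes by (elim disjE exE conjE) simp_all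
qed

definition surface :: "complex option set topology" where
  "surface = (SOME S. quotient_map (subtopology sphere_space (holed_sphere (2*h) a r)) S point_class)"

lemma quotient_map_surface:
  "quotient_map (subtopology sphere_space (holed_sphere (2*h) a r)) surface point_class"
  unfolding surface_def by (rule someI_ex) (rule exists_quotient_map)

lemma surface_Euler_genus: "surface_of_Euler_genus surface (2 * h)"
  unfolding surface_of_Euler_genus_def
  by (intro exI[of _ h] exI[of _ "0::nat"] exI[of _ a] exI[of _ r] exI[of _ point_class])
    (use radius_pos disjoint_holes quotient_map_surface in \<open>simp add: point_class_eq_iff\<close>)

definition proj :: "complex \<Rightarrow> complex option set" where
  "proj w = point_class (Some w)"

lemma proj_eq_iff: "proj u = proj v \<longleftrightarrow> u = v \<or> twins u v \<or> twins v u"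
  unfolding proj_def point_class_eq_iff glued_iff_twins by auto

text \<open>Only one of the two points has to avoid the closed holes. Through this lemma,
  disjointness on the surface is reduced to disjointness in the plane.\<close>

lemma proj_eq_outside: "proj u = proj v \<Longrightarrow> u \<notin> closed_holes \<Longrightarrow> u = v"
  using proj_eq_iff twins_closed_holes by blast

lemma continuous_proj: "continuous_map (top_of_set (- holes)) surface proj"
proof -
  have "continuous_map (top_of_set (- holes)) sphere_space Some"
    unfolding sphere_space_def by (intro continuous_map_from_subtopology continuous_map_Some)
  then have "continuous_map (top_of_set (- holes))
      (subtopology sphere_space (holed_sphere (2*h) a r)) Some"
    by (rule continuous_map_into_subtopology)
      (auto simp: holed_sphere_def sphere_space_def holes_def)
  from continuous_map_compose[OF this quotient_imp_continuous_map[OF quotient_map_surface]]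
  show ?thesis
    by (simp add: proj_def[abs_def] comp_def)
qed

lemma proj_in_surface: "w \<notin> holes \<Longrightarrow> proj w \<in> topspace surface"
  using continuous_map_image_subset_topspace[OF continuous_proj] by auto

text \<open>The saturation of a compact set adds finitely many compact reflected pieces, so the projection
  is closed on compact sets. This replaces the Hausdorff property of the surface.\<close>

lemma closedin_proj_compact:
  assumes "compact K" "K \<inter> holes = {}"
  shows "closedin surface (proj ` K)"
proof -
  let ?X = "subtopology sphere_space (holed_sphere (2*h) a r)"
  define refl where "refl i j = mirror i j ` (K \<inter> sphere (a i) (r i))" for i j
  define L where "L = K \<union> (\<Union>i<h. refl (2*i) (2*i+1) \<union> refl (2*i+1) (2*i))"
  have "compact (refl i j)" for i j
    unfolding refl_def using assms(1) by (intro compact_continuous_image continuous_mirror) auto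
  then have "compact L"
    unfolding L_def using assms(1) by (intro compact_Un compact_UN) auto
  then have closed_L: "closedin sphere_space (Some ` L)"
    unfolding sphere_space_def by (simp add: compact_imp_closed)
  have saturation: "w \<in> L \<longleftrightarrow> (\<exists>u\<in>K. u = w \<or> twins u w \<or> twins w u)" for w
  proof
    assume "w \<in> L"
    then consider "w \<in> K" | i where "i < h" "w \<in> refl (2*i) (2*i+1)"
      | i where "i < h" "w \<in> refl (2*i+1) (2*i)"
      unfolding L_def by blast
    then show "\<exists>u\<in>K. u = w \<or> twins u w \<or> twins w u"
    proof cases
      case 2
      then show ?thesis
        unfolding refl_def twins_def by blast
    next
      case 3
      then obtain u where u: "u \<in> K" "u \<in> sphere (a (2*i+1)) (r (2*i+1))" "w = mirror (2*i+1) (2*i) u"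
        unfolding refl_def by blast
      then have "twins w u"
        unfolding twins_def using 3 mirror_sphere[of "2*i+1" "2*i" u] mirror_mirror[of "2*i+1" "2*i" u]
        by (intro exI[of _ i]) simp
      then show ?thesis using u by blast
    qed blast
  next
    assume "\<exists>u\<in>K. u = w \<or> twins u w \<or> twins w u"
    then obtain u where u: "u \<in> K" and cases: "u = w \<or> twins u w \<or> twins w u"
      by blast
    from cases show "w \<in> L"
    proof (elim disjE)
      assume uw: "twins u w"
      obtain i where "i < h" "u \<in> sphere (a (2*i)) (r (2*i))" "w = mirror (2*i) (2*i+1) u"
        using twins_sphere[OF uw] by blast
      then show ?thesis
        unfolding L_def refl_def using u by blast
    next
      assume wu: "twins w u"
      obtain i where "i < h" "u \<in> sphere (a (2*i+1)) (r (2*i+1))" "w = mirror (2*i+1) (2*i) u"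
        using twins_sphere[OF wu] by blast
      then show ?thesis
        unfolding L_def refl_def using u by blast
    qed (use u L_def in simp)
  qed
  have pre: "{x \<in> topspace ?X. point_class x \<in> proj ` K} = Some ` L \<inter> topspace ?X"
  proof (intro set_eqI)
    fix x
    show "x \<in> {x \<in> topspace ?X. point_class x \<in> proj ` K} \<longleftrightarrow> x \<in> Some ` L \<inter> topspace ?X"
    proof (cases x)
      case None
      then show ?thesis
        by (auto simp: proj_def point_class_eq_iff glued_iff_twins)
    next
      case (Some w)
      have "point_class (Some w) \<in> proj ` K \<longleftrightarrow> w \<in> L"
        using saturation proj_eq_iff by (fold proj_def) (auto simp: image_iff)
      then show ?thesis using Some by auto
    qed
  qed
  have "closedin ?X (Some ` L \<inter> topspace ?X)"
    using closed_L unfolding closedin_subtopology by auto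
  then have "closedin ?X {x \<in> topspace ?X. point_class x \<in> proj ` K}"
    using pre by simp
  moreover have "proj ` K \<subseteq> topspace surface"
    using proj_in_surface assms(2) by blast
  ultimately show ?thesis
    using quotient_map_surface unfolding quotient_map_closedin by blast
qed

text \<open>A continuous closed injection is an embedding. A closed subset of \<open>D\<close> is
  compact, so its image in the plane is compact and has a closed projection.\<close>

lemma embedding_proj:
  assumes "compact D" "continuous_on D f" "inj_on f D" "f ` D \<inter> holes = {}" "inj_on proj (f ` D)"
  shows "embedding_map (top_of_set D) surface (\<lambda>x. proj (f x))"
proof (rule injective_closed_imp_embedding_map)
  have "continuous_map (top_of_set D) (top_of_set (- holes)) f"
    using assms(2,4) by (auto simp: continuous_map_in_subtopology)
  from continuous_map_compose[OF this continuous_proj]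
  show "continuous_map (top_of_set D) surface (\<lambda>x. proj (f x))"
    by (simp add: comp_def)
  show "closed_map (top_of_set D) surface (\<lambda>x. proj (f x))"
    unfolding closed_map_def
  proof (intro allI impI)
    fix C assume C: "closedin (top_of_set D) C"
    then have "C \<subseteq> D" "compact C"
      using closedin_imp_subset closedin_compact[OF assms(1)] by auto
    then have "closedin surface (proj ` (f ` C))"
      using assms by (intro closedin_proj_compact compact_continuous_image)
        (auto intro: continuous_on_subset)
    then show "closedin surface ((\<lambda>x. proj (f x)) ` C)"
      by (simp add: image_image)
  qed
  show "inj_on (\<lambda>x. proj (f x)) (topspace (top_of_set D))"
    using comp_inj_on[OF assms(3,5)] by (simp add: comp_def)
qed

end

section \<open>Straight-line drawings in the plane with holes\<close>

text \<open>An edge is drawn as a segment from \<^term>\<open>P e\<close> to \<^term>\<open>Q e\<close>. The second end may be the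
  point glued to the position of the end vertex.\<close>

locale drawing = handles h a r for h a r +
  fixes V :: "'v set" and pos :: "'v \<Rightarrow> complex" and E :: "'v set set"
    and P Q :: "'v set \<Rightarrow> complex"
  assumes finite_V: "finite V"
    and inj_pos: "inj_on pos V"
    and pos_not_twins: "\<lbrakk>u \<in> V; v \<in> V\<rbrakk> \<Longrightarrow> \<not> twins (pos u) (pos v)"
    and pos_holes: "v \<in> V \<Longrightarrow> pos v \<notin> holes"
    and edge_ends: "e \<in> E \<Longrightarrow>
      \<exists>u\<in>V. \<exists>v\<in>V. u \<noteq> v \<and> e = {u, v} \<and> P e = pos u \<and> (Q e = pos v \<or> twins (pos v) (Q e))"
    and P_not_Q: "e \<in> E \<Longrightarrow> P e \<noteq> Q e"
    and segment_holes: "e \<in> E \<Longrightarrow> closed_segment (P e) (Q e) \<inter> closed_holes \<subseteq> {Q e}"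
    and Q_holes: "e \<in> E \<Longrightarrow> Q e \<notin> holes"
    and segments_disjoint: "disjoint_family_on (\<lambda>e. open_segment (P e) (Q e)) E"
    and segment_pos: "e \<in> E \<Longrightarrow> open_segment (P e) (Q e) \<inter> pos ` V = {}"
begin

definition arc_of :: "'v set \<Rightarrow> real \<Rightarrow> complex option set" where
  "arc_of e t = proj (linepath (P e) (Q e) t)"

definition drawn_graph :: "'v ugraph" where
  "drawn_graph = UGraph V E"

lemma linepath_open_interval:
  assumes "p \<noteq> q"
  shows "linepath p q ` {0<..<1} = open_segment p (q :: complex)"
  unfolding open_segment_image_interval linepath_def using assms by auto

lemma simple_graph_drawn: "simple_graph drawn_graph"
proof -
  have "e \<subseteq> V \<and> card e = 2" if "e \<in> E" for e
    using edge_ends[OF that] by auto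
  then show ?thesis
    unfolding simple_graph_def drawn_graph_def using finite_V by simp
qed

lemma open_segment_holes: "e \<in> E \<Longrightarrow> open_segment (P e) (Q e) \<inter> closed_holes = {}"
  using segment_holes unfolding open_segment_def by blast

lemma arc_interior: "e \<in> E \<Longrightarrow> arc_of e ` {0<..<1} = proj ` open_segment (P e) (Q e)"
  unfolding arc_of_def using linepath_open_interval[OF P_not_Q] by (metis image_image)

lemma graph_embedding_drawn: "graph_embedding drawn_graph surface (\<lambda>v. proj (pos v)) arc_of"
  unfolding graph_embedding_def drawn_graph_def ugraph.sel
proof (intro conjI ballI)
  show "(\<lambda>v. proj (pos v)) ` V \<subseteq> topspace surface"
    using proj_in_surface pos_holes by blast
  show "inj_on (\<lambda>v. proj (pos v)) V"
    using inj_pos pos_not_twins unfolding inj_on_def proj_eq_iff by blast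
  show "disjoint_family_on (\<lambda>e. arc_of e ` {0<..<1}) E"
    unfolding disjoint_family_on_def
  proof (intro ballI impI)
    fix e f assume "e \<in> E" "f \<in> E" "e \<noteq> f"
    then show "arc_of e ` {0<..<1} \<inter> arc_of f ` {0<..<1} = {}"
      using segments_disjoint open_segment_holes[of e] proj_eq_outside
      unfolding disjoint_family_on_def by (simp add: arc_interior) blast
  qed
next
  fix e assume e: "e \<in> E"
  show "embedding_map (top_of_set {0..1}) surface (arc_of e)"
    unfolding arc_of_def
  proof (rule embedding_proj)
    show "inj_on (linepath (P e) (Q e)) {0..1}"
      using P_not_Q[OF e] inj_on_linepath by blast
    have "linepath (P e) (Q e) ` {0..1} = closed_segment (P e) (Q e)"
      by (rule linepath_image_01)
    moreover have "closed_segment (P e) (Q e) \<inter> holes = {}"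
      using segment_holes[OF e] Q_holes[OF e] holes_subset by blast
    \<comment> \<open>Only \<open>Q e\<close> can lie in a closed hole, so of two distinct points of
      the segment at least one lies outside, and its projection is shared with no other
      point.\<close>
    moreover have "inj_on proj (closed_segment (P e) (Q e))"
      using segment_holes[OF e] twins_closed_holes proj_eq_iff proj_eq_outside
      unfolding inj_on_def by (metis IntI singletonD subsetD)
    ultimately show "linepath (P e) (Q e) ` {0..1} \<inter> holes = {}"
      "inj_on proj (linepath (P e) (Q e) ` {0..1})"
      by simp_all
  qed (auto intro: continuous_intros)
  obtain u v where uv: "u \<in> V" "v \<in> V" "e = {u, v}" "P e = pos u"
      "Q e = pos v \<or> twins (pos v) (Q e)"
    using edge_ends[OF e] by blast
  then have "proj (Q e) = proj (pos v)"
    unfolding proj_eq_iff by auto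
  then show "{arc_of e 0, arc_of e 1} = (\<lambda>v. proj (pos v)) ` e"
    using uv by (auto simp: arc_of_def linepath_def)
  show "arc_of e ` {0<..<1} \<inter> (\<lambda>v. proj (pos v)) ` V = {}"
    using segment_pos[OF e] open_segment_holes[OF e] proj_eq_outside
    unfolding arc_interior[OF e] by blast
qed

text \<open>Open segments suffice: \<open>Q e\<close> may differ from the position of the end
  vertex, but both have the same projection. Conditions on discs thus concern only vertex positions
  and open segments.\<close>

lemma embedded_points_drawn:
  "embedded_points drawn_graph (\<lambda>v. proj (pos v)) arc_of =
     proj ` (pos ` V \<union> (\<Union>e\<in>E. open_segment (P e) (Q e)))"
proof -
  have "arc_of e ` {0..1} = proj ` open_segment (P e) (Q e) \<union> {arc_of e 0, arc_of e 1}" if "e \<in> E" for e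
  proof -
    have "{0..1::real} = {0<..<1} \<union> {0, 1}" by auto
    then show ?thesis
      using arc_interior[OF that] by auto
  qed
  moreover have "{arc_of e 0, arc_of e 1} \<subseteq> (\<lambda>v. proj (pos v)) ` V" if "e \<in> E" for e
  proof -
    have "{arc_of e 0, arc_of e 1} = (\<lambda>v. proj (pos v)) ` e" "e \<subseteq> V"
      using graph_embedding_drawn simple_graph_drawn that
      unfolding graph_embedding_def simple_graph_def drawn_graph_def by auto
    then show ?thesis by auto
  qed
  ultimately show ?thesis
    unfolding embedded_points_def drawn_graph_def ugraph.sel image_Un image_UN image_image by auto
qed

text \<open>The disc avoids the closed holes, so it meets the drawing on the surface only where it
  meets it in the plane. Since all angles lie in the half-open interval from -pi to pi, the
  increasing list of boundary vertices goes round the circle less than once.\<close>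

lemma vortex_disc_drawn:
  assumes "0 < \<rho>" and D_holes: "cball c \<rho> \<inter> closed_holes = {}"
    and D_segments: "\<And>e. e \<in> E \<Longrightarrow> open_segment (P e) (Q e) \<inter> cball c \<rho> = {}"
    and D_pos: "{v \<in> V. pos v \<in> cball c \<rho>} = set \<Omega>"
    and pos_ang: "\<And>v. v \<in> set \<Omega> \<Longrightarrow> pos v = c + of_real \<rho> * cis (ang v)"
    and sorted: "sorted_wrt (\<lambda>u v. ang u < ang v) \<Omega>"
    and ang_range: "\<And>v. v \<in> set \<Omega> \<Longrightarrow> -pi < ang v \<and> ang v \<le> pi"
  shows "vortex_disc drawn_graph surface (\<lambda>v. proj (pos v)) arc_of \<Omega> (\<lambda>w. proj (c + of_real \<rho> * w))"
proof -
  let ?f = "\<lambda>w. c + of_real \<rho> * w"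
  have f_cball: "?f w \<in> cball c \<rho>" if "w \<in> cball 0 1" for w
    using that \<open>0 < \<rho>\<close> by (auto simp: dist_norm norm_mult)
  have outside: "?f w \<notin> closed_holes" if "w \<in> cball 0 1" for w
    using D_holes f_cball[OF that] by blast
  have on_sphere: "cmod w = 1" if "?f w = pos v" "v \<in> set \<Omega>" for v w
    using pos_ang[OF that(2)] that(1) \<open>0 < \<rho>\<close> by simp
  have meets: "?f w \<in> pos ` set \<Omega>" if w: "w \<in> cball 0 1"
    and emb: "proj (?f w) \<in> embedded_points drawn_graph (\<lambda>v. proj (pos v)) arc_of" for w
  proof -
    obtain x where "proj (?f w) = proj x" and x: "x \<in> pos ` V \<union> (\<Union>e\<in>E. open_segment (P e) (Q e))"
      using emb unfolding embedded_points_drawn by blast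
    then have fw: "?f w = x"
      using proj_eq_outside[OF _ outside[OF w]] by simp
    have xD: "x \<in> cball c \<rho>"
      using f_cball[OF w] unfolding fw .
    have "x \<notin> open_segment (P e) (Q e)" if "e \<in> E" for e
      using D_segments[OF that] xD by blast
    then obtain v where "v \<in> V" "x = pos v"
      using x by blast
    moreover from this have "v \<in> set \<Omega>"
      using D_pos xD by blast
    ultimately show ?thesis
      unfolding fw by blast
  qed
  show ?thesis
    unfolding vortex_disc_def
  proof (intro conjI)
    show "embedding_map (top_of_set (cball 0 1)) surface (\<lambda>w. proj (?f w))"
    proof (rule embedding_proj)
      show "inj_on ?f (cball 0 1)"
        using \<open>0 < \<rho>\<close> by (auto simp: inj_on_def)
      show "?f ` cball 0 1 \<inter> holes = {}"
        using outside holes_subset by blast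
      show "inj_on proj (?f ` cball 0 1)"
        unfolding inj_on_def using outside proj_eq_outside by blast
    qed (auto intro!: continuous_intros)
    show "(\<lambda>w. proj (?f w)) ` ball 0 1 \<inter> embedded_points drawn_graph (\<lambda>v. proj (pos v)) arc_of = {}"
    proof (intro equals0I)
      fix x assume "x \<in> (\<lambda>w. proj (?f w)) ` ball 0 1 \<inter> embedded_points drawn_graph (\<lambda>v. proj (pos v)) arc_of"
      then obtain w where w: "cmod w < 1" "?f w \<in> pos ` set \<Omega>"
        using meets by force
      then show False
        using on_sphere by auto
    qed
    show "(\<lambda>w. proj (?f w)) ` sphere 0 1 \<inter> embedded_points drawn_graph (\<lambda>v. proj (pos v)) arc_of
        \<subseteq> (\<lambda>v. proj (pos v)) ` verts drawn_graph"
    proof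
      fix x assume "x \<in> (\<lambda>w. proj (?f w)) ` sphere 0 1 \<inter> embedded_points drawn_graph (\<lambda>v. proj (pos v)) arc_of"
      then obtain w where w: "x = proj (?f w)" "?f w \<in> pos ` set \<Omega>"
        using meets by force
      then show "x \<in> (\<lambda>v. proj (pos v)) ` verts drawn_graph"
        using D_pos unfolding drawn_graph_def by auto
    qed
    show "(\<lambda>w. proj (?f w)) ` sphere 0 1 \<inter> (\<lambda>v. proj (pos v)) ` verts drawn_graph
        = (\<lambda>v. proj (pos v)) ` set \<Omega>"
    proof (intro equalityI subsetI)
      fix x assume "x \<in> (\<lambda>w. proj (?f w)) ` sphere 0 1 \<inter> (\<lambda>v. proj (pos v)) ` verts drawn_graph"
      then obtain w v where wv: "cmod w = 1" "x = proj (?f w)" "v \<in> V" "x = proj (pos v)"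
        unfolding drawn_graph_def by auto
      then have "?f w = pos v" "?f w \<in> cball c \<rho>"
        using proj_eq_outside[of "?f w" "pos v"] outside[of w] f_cball[of w] by auto
      then show "x \<in> (\<lambda>v. proj (pos v)) ` set \<Omega>"
        using wv D_pos by auto
    next
      fix x assume "x \<in> (\<lambda>v. proj (pos v)) ` set \<Omega>"
      then obtain v where v: "v \<in> set \<Omega>" "x = proj (pos v)" by blast
      then have "v \<in> V" "x = proj (?f (cis (ang v)))"
        using D_pos pos_ang by auto
      then show "x \<in> (\<lambda>w. proj (?f w)) ` sphere 0 1 \<inter> (\<lambda>v. proj (pos v)) ` verts drawn_graph"
        using v unfolding drawn_graph_def by auto
    qed
    show "\<exists>\<theta>::nat \<Rightarrow> real. strict_mono_on {..<length \<Omega>} \<theta> \<and>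
        (\<forall>j<length \<Omega>. \<theta> j < \<theta> 0 + 2 * pi \<and> proj (pos (\<Omega> ! j)) = proj (?f (cis (\<theta> j))))"
    proof (intro exI[of _ "\<lambda>j. ang (\<Omega> ! j)"] conjI allI impI)
      show "strict_mono_on {..<length \<Omega>} (\<lambda>j. ang (\<Omega> ! j))"
        using sorted unfolding sorted_wrt_iff_nth_less strict_mono_on_def by simp
    next
      fix j assume j: "j < length \<Omega>"
      then have "\<Omega> ! 0 \<in> set \<Omega>" "\<Omega> ! j \<in> set \<Omega>"
        by (metis length_pos_if_in_set nth_mem)+
      then show "ang (\<Omega> ! j) < ang (\<Omega> ! 0) + 2 * pi"
        "proj (pos (\<Omega> ! j)) = proj (?f (cis (ang (\<Omega> ! j))))"
        using ang_range[of "\<Omega> ! 0"] ang_range[of "\<Omega> ! j"] pos_ang by auto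
    qed
  qed
qed

end

section \<open>Vortices with hubs\<close>

text \<open>A set of positions without gaps is an interval \<open>{lo..hi}\<close>. Starting at
  \<open>lo\<close> it ends before the list does, so the reduction modulo the length changes
  nothing; the empty set is the interval of length 0.\<close>

lemma cyclically_consecutive_convex:
  assumes "\<And>i j l. i < j \<Longrightarrow> j < l \<Longrightarrow> l < length \<Omega> \<Longrightarrow> \<Omega> ! i \<in> S \<Longrightarrow> \<Omega> ! l \<in> S \<Longrightarrow> \<Omega> ! j \<in> S"
    and "S \<subseteq> set \<Omega>"
  shows "cyclically_consecutive \<Omega> S"
proof -
  define J where "J = {i. i < length \<Omega> \<and> \<Omega> ! i \<in> S}"
  have S: "S = (!) \<Omega> ` J"
    using assms(2) unfolding J_def by (force simp: in_set_conv_nth)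
  show ?thesis
  proof (cases "J = {}")
    case True
    then show ?thesis
      unfolding cyclically_consecutive_def S by (intro exI[of _ 0]) simp
  next
    case False
    have fin: "finite J" unfolding J_def by simp
    define lo hi where "lo = Min J" and "hi = Max J"
    have lohi: "lo \<in> J" "hi \<in> J" "\<And>j. j \<in> J \<Longrightarrow> lo \<le> j \<and> j \<le> hi"
      using fin False by (auto simp: lo_def hi_def)
    have J: "J = {lo..hi}"
    proof
      show "{lo..hi} \<subseteq> J"
      proof
        fix j assume "j \<in> {lo..hi}"
        then consider "j = lo" | "j = hi" | "lo < j" "j < hi" by fastforce
        then show "j \<in> J"
          using lohi(1,2) assms(1)[of lo j hi] unfolding J_def by cases auto
      qed
    qed (use lohi in auto)
    also have "\<dots> = (\<lambda>i. lo + i) ` {..<Suc hi - lo}"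
      using lohi(3)[OF lohi(1)] by (simp add: image_add_atLeastLessThan lessThan_atLeast0 atLeastLessThanSuc_atLeastAtMost)
    finally have "S = (\<lambda>i. \<Omega> ! (lo + i)) ` {..<Suc hi - lo}"
      unfolding S by (simp add: image_image)
    also have "\<dots> = (\<lambda>i. \<Omega> ! ((lo + i) mod length \<Omega>)) ` {..<Suc hi - lo}"
      using lohi(2) by (intro image_cong) (auto simp: J_def)
    finally show ?thesis
      unfolding cyclically_consecutive_def by blast
  qed
qed

text \<open>Every bag consists of a boundary vertex and the hubs of its group. As the groups are
  contiguous, the hubs of a group lie in consecutive bags.\<close>

lemma hub_vortex:
  fixes ang :: "'v \<Rightarrow> real" and grp :: "'v \<Rightarrow> nat"
  assumes sorted: "sorted_wrt (\<lambda>u v. ang u < ang v) \<Omega>" and "\<Omega> \<noteq> []"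
    and grp_mono: "\<And>u v. u \<in> set \<Omega> \<Longrightarrow> v \<in> set \<Omega> \<Longrightarrow> ang u < ang v \<Longrightarrow> grp u \<le> grp v"
    and hub_finite: "\<And>i. finite (Hub i)" and hub_card: "\<And>i. card (Hub i) \<le> k"
    and hub_disjoint: "disjoint_family Hub"
    and hub_boundary: "\<And>i. Hub i \<inter> set \<Omega> = {}"
    and edges: "\<And>e. e \<in> F \<Longrightarrow> card e = 2 \<and> (\<exists>w\<in>set \<Omega>. e \<subseteq> insert w (Hub (grp w)))"
  defines "W \<equiv> UGraph (set \<Omega> \<union> (\<Union>w\<in>set \<Omega>. Hub (grp w))) F"
  shows "vortex W \<Omega>" and "vortex_width W \<Omega> \<le> k"
proof -
  have "sorted_wrt (<) (map ang \<Omega>)"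
    using sorted by (simp add: sorted_wrt_map)
  then have dist: "distinct \<Omega>"
    using strict_sorted_iff distinct_map by blast
  have fin: "finite (verts W)"
    unfolding W_def using hub_finite by simp
  have "e \<subseteq> verts W" if "e \<in> F" for e
    using edges[OF that] unfolding W_def by auto
  then show "vortex W \<Omega>"
    unfolding vortex_def simple_graph_def
    using fin dist \<open>\<Omega> \<noteq> []\<close> edges unfolding W_def by auto
  define C where "C w = insert w (Hub (grp w))" for w
  have consecutive: "cyclically_consecutive \<Omega> {w \<in> set \<Omega>. u \<in> C w}" if u: "u \<in> verts W" for u
  proof (cases "u \<in> set \<Omega>")
    case True
    then have *: "{w \<in> set \<Omega>. u \<in> C w} = {u}"
      using hub_boundary unfolding C_def by blast
    show ?thesis
    proof (rule cyclically_consecutive_convex)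
      fix i j l assume ijl: "i < j" "j < l" "l < length \<Omega>"
        "\<Omega> ! i \<in> {w \<in> set \<Omega>. u \<in> C w}" "\<Omega> ! l \<in> {w \<in> set \<Omega>. u \<in> C w}"
      then have "\<Omega> ! i = \<Omega> ! l" unfolding * by simp
      then have "i = l" using dist ijl by (simp add: nth_eq_iff_index_eq)
      then show "\<Omega> ! j \<in> {w \<in> set \<Omega>. u \<in> C w}" using ijl by simp
    qed simp
  next
    case False
    then obtain i0 where i0: "u \<in> Hub i0"
      using u unfolding W_def by auto
    then have "u \<in> C w \<longleftrightarrow> grp w = i0" if "w \<in> set \<Omega>" for w
      using False that hub_disjoint unfolding C_def disjoint_family_on_def by blast
    then have *: "{w \<in> set \<Omega>. u \<in> C w} = {w \<in> set \<Omega>. grp w = i0}" by blast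
    show ?thesis
    proof (rule cyclically_consecutive_convex)
      fix i j l assume ijl: "i < j" "j < l" "l < length \<Omega>"
        "\<Omega> ! i \<in> {w \<in> set \<Omega>. u \<in> C w}" "\<Omega> ! l \<in> {w \<in> set \<Omega>. u \<in> C w}"
      then have "ang (\<Omega> ! i) < ang (\<Omega> ! j)" "ang (\<Omega> ! j) < ang (\<Omega> ! l)"
        using sorted unfolding sorted_wrt_iff_nth_less by auto
      then have "grp (\<Omega> ! i) \<le> grp (\<Omega> ! j)" "grp (\<Omega> ! j) \<le> grp (\<Omega> ! l)"
        using grp_mono ijl by (auto intro: nth_mem)
      then show "\<Omega> ! j \<in> {w \<in> set \<Omega>. u \<in> C w}"
        using ijl unfolding * by auto
    qed simp
  qed
  have "circular_decomposition W \<Omega> C"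
    unfolding circular_decomposition_def
    using consecutive edges by (auto simp: W_def C_def)
  moreover have "decomposition_width \<Omega> C \<le> k"
  proof -
    \<comment> \<open>A bag has one boundary vertex besides its hubs. The width subtracts 1 from the
      bag size, so all \<open>k\<close> hubs can be afforded.\<close>
    have "card (C w) \<le> Suc k" for w
      unfolding C_def using hub_card[of "grp w"] hub_finite[of "grp w"] by (simp add: card_insert_if le_SucI)
    then have "Max ((\<lambda>w. card (C w)) ` set \<Omega>) \<le> Suc k"
      using \<open>\<Omega> \<noteq> []\<close> by (subst Max_le_iff) auto
    then show ?thesis unfolding decomposition_width_def by simp
  qed
  ultimately show "vortex_width W \<Omega> \<le> k"
    unfolding vortex_width_def by (metis (mono_tags, lifting) Least_le order_trans)
qed

lemma sorted_list_by_key: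
  fixes ang :: "'v \<Rightarrow> real"
  assumes "finite X" "inj_on ang X"
  shows "\<exists>\<Omega>. set \<Omega> = X \<and> sorted_wrt (\<lambda>u v. ang u < ang v) \<Omega>"
proof -
  define \<Omega> where "\<Omega> = map (inv_into X ang) (sorted_list_of_set (ang ` X))"
  have "set \<Omega> = X"
    unfolding \<Omega>_def using assms by simp
  moreover have "map ang \<Omega> = sorted_list_of_set (ang ` X)"
    unfolding \<Omega>_def map_map using assms(1)
    by (intro map_idI) (simp add: f_inv_into_f)
  then have "sorted_wrt (<) (map ang \<Omega>)"
    using strict_sorted_list_of_set by simp
  ultimately show ?thesis
    by (auto simp: sorted_wrt_map)
qed

section \<open>Almost embeddable graphs from drawings\<close>

text \<open>\<open>X i\<close> is the boundary of vortex \<open>i\<close>, \<open>Hub i j\<close>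
  its group of hubs with number \<open>j\<close>, and \<open>F i\<close> its edge set;
  \<open>grp\<close> assigns to each boundary vertex the group in its bag. The boundary is a set
  with angles, from which the circular ordering is recovered by sorting.\<close>

locale layout = drawing h a r V pos E P Q for h a r and V :: "'v set" and pos E P Q +
  fixes q k :: nat and ctr :: "nat \<Rightarrow> complex" and rad :: "nat \<Rightarrow> real"
    and X :: "nat \<Rightarrow> 'v set" and ang :: "'v \<Rightarrow> real" and grp :: "'v \<Rightarrow> nat"
    and Hub :: "nat \<Rightarrow> nat \<Rightarrow> 'v set" and F :: "nat \<Rightarrow> 'v set set"
  assumes rad_pos: "i < q \<Longrightarrow> 0 < rad i"
    and disc_holes: "i < q \<Longrightarrow> cball (ctr i) (rad i) \<inter> closed_holes = {}"
    and disc_segments: "\<lbrakk>i < q; e \<in> E\<rbrakk> \<Longrightarrow> open_segment (P e) (Q e) \<inter> cball (ctr i) (rad i) = {}"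
    and disc_pos: "i < q \<Longrightarrow> {v \<in> V. pos v \<in> cball (ctr i) (rad i)} = X i"
    and discs_disjoint: "disjoint_family_on (\<lambda>i. cball (ctr i) (rad i)) {..<q}"
    and X_nonempty: "i < q \<Longrightarrow> X i \<noteq> {}"
    and pos_ang: "\<lbrakk>i < q; v \<in> X i\<rbrakk> \<Longrightarrow> pos v = ctr i + of_real (rad i) * cis (ang v)"
    and ang_range: "\<lbrakk>i < q; v \<in> X i\<rbrakk> \<Longrightarrow> -pi < ang v \<and> ang v \<le> pi"
    and grp_mono: "\<lbrakk>i < q; u \<in> X i; v \<in> X i; ang u < ang v\<rbrakk> \<Longrightarrow> grp u \<le> grp v"
    and hub_finite: "finite (Hub i j)" and hub_card: "card (Hub i j) \<le> k"
    and hub_unique: "\<lbrakk>v \<in> Hub i j; v \<in> Hub i' j'\<rbrakk> \<Longrightarrow> i = i' \<and> j = j'"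
    and hub_V: "Hub i j \<inter> V = {}"
    and vortex_edges: "\<lbrakk>i < q; e \<in> F i\<rbrakk> \<Longrightarrow>
      card e = 2 \<and> (\<exists>w\<in>X i. e \<subseteq> insert w (Hub i (grp w)))"
begin

text \<open>Only groups selected by some boundary vertex are included, since every vertex of a
  vortex has to lie in a bag.\<close>

definition layout_graph :: "'v ugraph" where
  "layout_graph = UGraph (V \<union> (\<Union>i<q. \<Union>w\<in>X i. Hub i (grp w))) (E \<union> (\<Union>i<q. F i))"

lemma X_subset: "i < q \<Longrightarrow> X i \<subseteq> V"
  using disc_pos by blast

lemma almost_embeddable_layout:
  assumes "q \<le> p" "2 * h \<le> g"
  shows "almost_embeddable g p k layout_graph"
proof -
  have "\<exists>\<Omega>. set \<Omega> = X i \<and> sorted_wrt (\<lambda>u v. ang u < ang v) \<Omega>" if "i < q" for i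
  proof (rule sorted_list_by_key)
    show "finite (X i)"
      using X_subset[OF that] finite_V finite_subset by blast
    show "inj_on ang (X i)"
      using pos_ang[OF that] inj_pos X_subset[OF that] by (metis inj_on_def subsetD)
  qed
  then obtain \<Omega> where \<Omega>: "\<And>i. i < q \<Longrightarrow> set (\<Omega> i) = X i"
      "\<And>i. i < q \<Longrightarrow> sorted_wrt (\<lambda>u v. ang u < ang v) (\<Omega> i)"
    by metis
  define W where "W i = UGraph (X i \<union> (\<Union>w\<in>X i. Hub i (grp w))) (F i)" for i
  define \<delta> where "\<delta> i w = proj (ctr i + of_real (rad i) * w)" for i w
  have X_V: "X i \<inter> V = X i" if "i < q" for i
    using X_subset[OF that] by blast
  have X_disjoint: "X i \<inter> X j = {}" if "i < q" "j < q" "i \<noteq> j" for i j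
    using disc_pos[OF that(1)] disc_pos[OF that(2)] discs_disjoint that
    unfolding disjoint_family_on_def by blast
  have vortices: "vortex (W i) (\<Omega> i) \<and> vortex_width (W i) (\<Omega> i) \<le> k" if i: "i < q" for i
  proof -
    have hub: "disjoint_family (Hub i)" "\<And>j. Hub i j \<inter> set (\<Omega> i) = {}"
      using hub_unique hub_V X_subset[OF i] \<Omega>(1)[OF i] unfolding disjoint_family_on_def by blast+
    have ne: "\<Omega> i \<noteq> []"
      using X_nonempty[OF i] \<Omega>(1)[OF i] by auto
    have "vortex (UGraph (set (\<Omega> i) \<union> (\<Union>w\<in>set (\<Omega> i). Hub i (grp w))) (F i)) (\<Omega> i)"
      by (rule hub_vortex[OF \<Omega>(2)[OF i] ne _ hub_finite hub_card hub])
        (use grp_mono[OF i] vortex_edges[OF i] \<Omega>(1)[OF i] in auto)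
    moreover have "vortex_width (UGraph (set (\<Omega> i) \<union> (\<Union>w\<in>set (\<Omega> i). Hub i (grp w))) (F i)) (\<Omega> i) \<le> k"
      by (rule hub_vortex[OF \<Omega>(2)[OF i] ne _ hub_finite hub_card hub])
        (use grp_mono[OF i] vortex_edges[OF i] \<Omega>(1)[OF i] in auto)
    ultimately show ?thesis
      unfolding W_def \<Omega>(1)[OF i] by blast
  qed
  have discs: "vortex_disc drawn_graph surface (\<lambda>v. proj (pos v)) arc_of (\<Omega> i) (\<delta> i)" if i: "i < q" for i
    unfolding \<delta>_def
    using rad_pos[OF i] disc_holes[OF i] disc_segments[OF i] disc_pos[OF i] pos_ang[OF i]
      ang_range[OF i] \<Omega>[OF i]
    by (intro vortex_disc_drawn) auto
  have W_disjoint: "disjoint_family_on (\<lambda>i. verts (W i)) {..<q}"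
    unfolding disjoint_family_on_def
  proof (intro ballI impI equals0I)
    fix i j v assume ij: "i \<in> {..<q}" "j \<in> {..<q}" "i \<noteq> j" and v: "v \<in> verts (W i) \<inter> verts (W j)"
    then consider "v \<in> X i" "v \<in> X j" | l where "v \<in> Hub i l" "v \<in> X j"
      | l where "v \<in> X i" "v \<in> Hub j l" | l l' where "v \<in> Hub i l" "v \<in> Hub j l'"
      unfolding W_def ugraph.sel by blast
    then show False
    proof cases
      case 1 then show ?thesis using X_disjoint ij by auto
    next
      case 2 then show ?thesis using hub_V X_subset ij by blast
    next
      case 3 then show ?thesis using hub_V X_subset ij by blast
    next
      case 4 then show ?thesis using hub_unique ij by blast
    qed
  qed
  have W_V: "verts (W i) \<inter> verts drawn_graph = set (\<Omega> i)" if "i < q" for i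
    using hub_V X_V[OF that] \<Omega>(1)[OF that] unfolding W_def drawn_graph_def by auto
  \<comment> \<open>The discs are disjoint in the plane, and as they avoid the closed holes, the
    projection cannot make them meet.\<close>
  have \<delta>_disjoint: "disjoint_family_on (\<lambda>i. \<delta> i ` cball 0 1) {..<q}"
    unfolding disjoint_family_on_def
  proof (intro ballI impI equals0I)
    fix i j x assume ij: "i \<in> {..<q}" "j \<in> {..<q}" "i \<noteq> j" and "x \<in> \<delta> i ` cball 0 1 \<inter> \<delta> j ` cball 0 1"
    then obtain w w' where w: "cmod w \<le> 1" "cmod w' \<le> 1" "\<delta> i w = \<delta> j w'"
      by auto
    let ?u = "ctr i + of_real (rad i) * w" and ?v = "ctr j + of_real (rad j) * w'"
    have u: "?u \<in> cball (ctr i) (rad i)" and v: "?v \<in> cball (ctr j) (rad j)"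
      using w rad_pos[of i] rad_pos[of j] ij by (auto simp: dist_norm norm_mult)
    then have "?u = ?v"
      using w(3) proj_eq_outside[of ?u ?v] disc_holes[of i] ij unfolding \<delta>_def by blast
    with u v show False
      using discs_disjoint ij unfolding disjoint_family_on_def by (metis IntI empty_iff)
  qed
  have "layout_graph = UGraph (verts drawn_graph \<union> (\<Union>i<q. verts (W i)))
      (edges drawn_graph \<union> (\<Union>i<q. edges (W i)))"
    unfolding layout_graph_def drawn_graph_def W_def using X_subset by auto
  then show ?thesis
    unfolding almost_embeddable_def
    using surface_Euler_genus assms simple_graph_drawn graph_embedding_drawn vortices discs
      W_disjoint W_V \<delta>_disjoint
    by (intro exI[of _ surface] exI[of _ "2 * h"] exI[of _ drawn_graph] exI[of _ "\<lambda>v. proj (pos v)"]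
        exI[of _ arc_of] exI[of _ q] exI[of _ W] exI[of _ \<Omega>] exI[of _ \<delta>] conjI allI impI) auto
qed

end

section \<open>Relabelling vertices\<close>

text \<open>The constructions use datatypes as vertex types, whereas the final graph has natural
  numbers as vertices. An injective renaming transports minors and almost embeddings.\<close>

definition relabel :: "('v \<Rightarrow> 'w) \<Rightarrow> 'v ugraph \<Rightarrow> 'w ugraph" where
  "relabel f G = UGraph (f ` verts G) ((`) f ` edges G)"

lemma verts_relabel [simp]: "verts (relabel f G) = f ` verts G"
  and edges_relabel [simp]: "edges (relabel f G) = (`) f ` edges G"
  by (simp_all add: relabel_def)

lemma simple_graph_relabel:
  assumes "simple_graph G" "inj_on f (verts G)"
  shows "simple_graph (relabel f G)"
  using assms unfolding simple_graph_def
  by (auto simp: card_image inj_on_subset)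

lemma is_minor_relabel:
  assumes "is_minor H G" "inj_on f (verts G)"
  shows "is_minor H (relabel f G)"
proof -
  obtain B where B: "\<And>x. x \<in> verts H \<Longrightarrow> connected_in G (B x)" "disjoint_family_on B (verts H)"
      "\<And>x y. {x, y} \<in> edges H \<Longrightarrow> \<exists>u\<in>B x. \<exists>v\<in>B y. {u, v} \<in> edges G"
    using assms(1) unfolding is_minor_def by metis
  have "connected_in (relabel f G) (f ` S)" if S: "connected_in G S" for S
  proof -
    have "(f x, f y) \<in> {(u, v). u \<in> f ` S \<and> v \<in> f ` S \<and> {u, v} \<in> edges (relabel f G)}\<^sup>*"
      if "(x, y) \<in> {(u, v). u \<in> S \<and> v \<in> S \<and> {u, v} \<in> edges G}\<^sup>*" for x y
      using that
    proof (induction rule: rtrancl_induct)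
      case (step y z)
      then have "(f y, f z) \<in> {(u, v). u \<in> f ` S \<and> v \<in> f ` S \<and> {u, v} \<in> edges (relabel f G)}"
        by (auto intro: rev_image_eqI[of "{y, z}"])
      with step.IH show ?case by (rule rtrancl_into_rtrancl)
    qed simp
    then show ?thesis
      using S unfolding connected_in_def by auto
  qed
  moreover have "disjoint_family_on (\<lambda>x. f ` B x) (verts H)"
    unfolding disjoint_family_on_def
  proof (intro ballI impI)
    fix x y assume xy: "x \<in> verts H" "y \<in> verts H" "x \<noteq> y"
    then have "B x \<subseteq> verts G" "B y \<subseteq> verts G" "B x \<inter> B y = {}"
      using B(1,2) unfolding connected_in_def disjoint_family_on_def by auto
    then show "f ` B x \<inter> f ` B y = {}"
      using inj_on_image_Int[OF assms(2)] by (metis image_empty)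
  qed
  moreover have "\<exists>u\<in>f ` B x. \<exists>v\<in>f ` B y. {u, v} \<in> edges (relabel f G)" if xy: "{x, y} \<in> edges H" for x y
  proof -
    obtain u v where "u \<in> B x" "v \<in> B y" "{u, v} \<in> edges G"
      using B(3)[OF xy] by blast
    then show ?thesis
      by (intro bexI[of _ "f u"] bexI[of _ "f v"]) (auto intro: rev_image_eqI[of "{u, v}"])
  qed
  ultimately show ?thesis
    unfolding is_minor_def using B(1) by (intro exI[of _ "\<lambda>x. f ` B x"]) blast
qed

lemma vortex_relabel:
  assumes "vortex G \<Omega>" "inj_on f (verts G)"
  shows "vortex (relabel f G) (map f \<Omega>)"
  using assms unfolding vortex_def
  by (auto simp: simple_graph_relabel distinct_map inj_on_subset)

lemma vortex_width_attained:
  assumes "vortex G \<Omega>"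
  obtains C where "circular_decomposition G \<Omega> C" "decomposition_width \<Omega> C = vortex_width G \<Omega>"
proof -
  have "cyclically_consecutive \<Omega> (set \<Omega>)"
    unfolding cyclically_consecutive_def
    by (intro exI[of _ 0] exI[of _ "length \<Omega>"]) (auto simp: set_conv_nth)
  then have "circular_decomposition G \<Omega> (\<lambda>_. verts G)"
    using assms unfolding circular_decomposition_def vortex_def simple_graph_def
    by (auto simp: ex_in_conv)
  then have "\<exists>m C. circular_decomposition G \<Omega> C \<and> m = decomposition_width \<Omega> C"
    by blast
  from LeastI_ex[OF this] show ?thesis
    using that unfolding vortex_width_def by metis
qed

text \<open>An upper bound is enough, so it suffices to push an optimal decomposition forward: the
  bag at a renamed vertex is the image of the old bag.\<close>

lemma vortex_width_relabel:
  assumes vortex: "vortex G \<Omega>" and f: "inj_on f (verts G)"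
  shows "vortex_width (relabel f G) (map f \<Omega>) \<le> vortex_width G \<Omega>"
proof -
  obtain C where C: "circular_decomposition G \<Omega> C" "decomposition_width \<Omega> C = vortex_width G \<Omega>"
    using vortex_width_attained[OF vortex] .
  define g where "g = inv_into (verts G) f"
  define C' where "C' w = f ` C (g w)" for w
  have \<Omega>: "set \<Omega> \<subseteq> verts G" "\<Omega> \<noteq> []"
    using vortex unfolding vortex_def by auto
  have C'_f: "C' (f w) = f ` C w" if "w \<in> set \<Omega>" for w
    using that \<Omega> f unfolding C'_def g_def by (auto simp: inv_into_f_f)
  have C_verts: "C w \<subseteq> verts G" "w \<in> C w" if "w \<in> set \<Omega>" for w
    using C(1) that unfolding circular_decomposition_def by auto
  have C_edges: "\<exists>w\<in>set \<Omega>. e \<subseteq> C w" if "e \<in> edges G" for e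
    using C(1) that unfolding circular_decomposition_def by auto
  have C_cover: "\<exists>w\<in>set \<Omega>. u \<in> C w" if "u \<in> verts G" for u
    using C(1) that unfolding circular_decomposition_def by auto
  have "cyclically_consecutive (map f \<Omega>) {w \<in> set (map f \<Omega>). f u \<in> C' w}" if u: "u \<in> verts G" for u
  proof -
    have "f u \<in> C' (f w) \<longleftrightarrow> u \<in> C w" if "w \<in> set \<Omega>" for w
      unfolding C'_f[OF that] using C_verts[OF that] u f by (auto dest: inj_onD)
    then have "{w \<in> set (map f \<Omega>). f u \<in> C' w} = f ` {w \<in> set \<Omega>. u \<in> C w}"
      by auto
    moreover obtain s l where "{w \<in> set \<Omega>. u \<in> C w} = (\<lambda>i. \<Omega> ! ((s + i) mod length \<Omega>)) ` {..<l}"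
      using C(1) u unfolding circular_decomposition_def cyclically_consecutive_def by blast
    ultimately show ?thesis
      unfolding cyclically_consecutive_def using \<Omega>
      by (intro exI[of _ s] exI[of _ l]) (auto simp: image_image)
  qed
  moreover have "\<exists>w\<in>set (map f \<Omega>). e \<subseteq> C' w" if e: "e \<in> edges (relabel f G)" for e
  proof -
    obtain e' where e': "e' \<in> edges G" "e = f ` e'"
      using e by auto
    obtain w where "w \<in> set \<Omega>" "e' \<subseteq> C w"
      using C_edges[OF e'(1)] by blast
    then show ?thesis
      using C'_f e'(2) by (intro bexI[of _ "f w"]) auto
  qed
  moreover have "\<exists>w\<in>set (map f \<Omega>). u \<in> C' w" if u: "u \<in> f ` verts G" for u
  proof -
    obtain u' where u': "u' \<in> verts G" "u = f u'"
      using u by auto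
    obtain w where "w \<in> set \<Omega>" "u' \<in> C w"
      using C_cover[OF u'(1)] by blast
    then show ?thesis
      using C'_f u'(2) by (intro bexI[of _ "f w"]) auto
  qed
  moreover have "C' w \<subseteq> verts (relabel f G) \<and> w \<in> C' w" if w: "w \<in> set (map f \<Omega>)" for w
  proof -
    obtain x where x: "x \<in> set \<Omega>" "w = f x"
      using w by auto
    show ?thesis
      unfolding x(2) C'_f[OF x(1)] verts_relabel using C_verts[OF x(1)] by blast
  qed
  ultimately have "circular_decomposition (relabel f G) (map f \<Omega>) C'"
    unfolding circular_decomposition_def by auto
  moreover have "card (C' (f w)) = card (C w)" if "w \<in> set \<Omega>" for w
    unfolding C'_f[OF that] using C_verts[OF that] f by (meson card_image inj_on_subset)
  then have "decomposition_width (map f \<Omega>) C' = vortex_width G \<Omega>"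
    unfolding C(2)[symmetric] decomposition_width_def by (simp add: image_image cong: image_cong_simp)
  ultimately show ?thesis
    unfolding vortex_width_def[of "relabel f G"] by (metis (mono_tags, lifting) Least_le)
qed

text \<open>The surface, the arcs and the discs stay as they are; only \<open>\<phi>\<close> and
  \<open>\<gamma>\<close> are composed with the inverse renaming, on vertices and on edges as
  sets.\<close>

lemma almost_embeddable_relabel:
  assumes "almost_embeddable g p k G" and f: "inj_on f (verts G)"
  shows "almost_embeddable g p k (relabel f G)"
proof -
  obtain S :: "complex option set topology" and e G0 \<phi> \<gamma> q Gs \<Omega> \<delta> where
    S: "surface_of_Euler_genus S e" "e \<le> g" and G0: "simple_graph G0" "graph_embedding G0 S \<phi> \<gamma>" and
    q: "q \<le> p" and vortices: "\<And>i. i < q \<Longrightarrow> vortex (Gs i) (\<Omega> i) \<and> vortex_width (Gs i) (\<Omega> i) \<le> k" and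
    G: "G = UGraph (verts G0 \<union> (\<Union>i<q. verts (Gs i))) (edges G0 \<union> (\<Union>i<q. edges (Gs i)))" and
    disj: "disjoint_family_on (\<lambda>i. verts (Gs i)) {..<q}" and
    boundary: "\<And>i. i < q \<Longrightarrow> verts (Gs i) \<inter> verts G0 = set (\<Omega> i)" and
    discs: "\<And>i. i < q \<Longrightarrow> vortex_disc G0 S \<phi> \<gamma> (\<Omega> i) (\<delta> i)" and
    \<delta>: "disjoint_family_on (\<lambda>i. \<delta> i ` cball 0 1) {..<q}"
    using assms(1) unfolding almost_embeddable_def by (elim exE conjE) metis
  define g where "g = inv_into (verts G) f"
  have gf: "g (f v) = v" if "v \<in> verts G" for v
    using that f by (simp add: g_def)
  have sub0: "verts G0 \<subseteq> verts G" and subs: "\<And>i. i < q \<Longrightarrow> verts (Gs i) \<subseteq> verts G"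
    unfolding G by auto
  note f0 = inj_on_subset[OF f sub0]
  have edge_sub: "d \<subseteq> verts G" "d \<subseteq> verts G0" if "d \<in> edges G0" for d
    using G0(1) sub0 that unfolding simple_graph_def by auto
  have g_image: "g ` f ` A = A" if "A \<subseteq> verts G" for A
    using that gf by (force simp: image_image)
  define \<phi>' where "\<phi>' v = \<phi> (g v)" for v
  define \<gamma>' where "\<gamma>' d = \<gamma> (g ` d)" for d
  have \<gamma>': "\<gamma>' (f ` d) = \<gamma> d" if "d \<in> edges G0" for d
    unfolding \<gamma>'_def g_image[OF edge_sub(1)[OF that]] ..
  have \<phi>': "\<phi>' ` f ` A = \<phi> ` A" if "A \<subseteq> verts G" for A
    using g_image[OF that] unfolding \<phi>'_def by (metis image_image)
  have emb: "graph_embedding (relabel f G0) S \<phi>' \<gamma>'"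
    unfolding graph_embedding_def verts_relabel edges_relabel \<phi>'[OF sub0]
  proof (intro conjI ballI)
    show "\<phi> ` verts G0 \<subseteq> topspace S"
      using G0(2) unfolding graph_embedding_def by blast
    have "inj_on \<phi> (verts G0)"
      using G0(2) unfolding graph_embedding_def by blast
    then show "inj_on \<phi>' (f ` verts G0)"
      unfolding inj_on_def \<phi>'_def using gf[OF subsetD[OF sub0]] by auto
    have "disjoint_family_on (\<lambda>d. \<gamma> d ` {0<..<1}) (edges G0)"
      using G0(2) unfolding graph_embedding_def by blast
    then show "disjoint_family_on (\<lambda>d. \<gamma>' d ` {0<..<1}) ((`) f ` edges G0)"
      unfolding disjoint_family_on_def by (auto simp: \<gamma>')
  next
    fix d' assume "d' \<in> (`) f ` edges G0"
    then obtain d where d: "d \<in> edges G0" "d' = f ` d" by blast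
    then show "embedding_map (top_of_set {0..1}) S (\<gamma>' d')"
      "{\<gamma>' d' 0, \<gamma>' d' 1} = \<phi>' ` d'" "\<gamma>' d' ` {0<..<1} \<inter> \<phi> ` verts G0 = {}"
      using G0(2) unfolding graph_embedding_def by (simp_all add: \<gamma>' \<phi>' edge_sub)
  qed
  have points: "embedded_points (relabel f G0) \<phi>' \<gamma>' = embedded_points G0 \<phi> \<gamma>"
    unfolding embedded_points_def verts_relabel edges_relabel \<phi>'[OF sub0] by (simp add: \<gamma>')
  have disc': "vortex_disc (relabel f G0) S \<phi>' \<gamma>' (map f (\<Omega> i)) (\<delta> i)" if i: "i < q" for i
  proof -
    have sub: "set (\<Omega> i) \<subseteq> verts G"
      using boundary[OF i] sub0 by blast
    then have "\<phi>' (map f (\<Omega> i) ! j) = \<phi> (\<Omega> i ! j)" if "j < length (\<Omega> i)" for j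
      using gf[OF subsetD[OF sub nth_mem[OF that]]] that unfolding \<phi>'_def by simp
    then show ?thesis
      using discs[OF i] unfolding vortex_disc_def points verts_relabel \<phi>'[OF sub0] set_map \<phi>'[OF sub]
      by simp
  qed
  have vortices': "vortex (relabel f (Gs i)) (map f (\<Omega> i)) \<and>
      vortex_width (relabel f (Gs i)) (map f (\<Omega> i)) \<le> k" if i: "i < q" for i
    using vortices[OF i] vortex_relabel[OF _ inj_on_subset[OF f subs[OF i]]]
      vortex_width_relabel[OF _ inj_on_subset[OF f subs[OF i]]] by (meson order_trans)
  have disj': "disjoint_family_on (\<lambda>i. verts (relabel f (Gs i))) {..<q}"
    unfolding disjoint_family_on_def verts_relabel
  proof (intro ballI impI)
    fix i j assume "i \<in> {..<q}" "j \<in> {..<q}" "i \<noteq> j"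
    then show "f ` verts (Gs i) \<inter> f ` verts (Gs j) = {}"
      using disj subs inj_on_image_Int[OF f, of "verts (Gs i)" "verts (Gs j)"]
      unfolding disjoint_family_on_def by (metis image_empty lessThan_iff)
  qed
  have boundary': "verts (relabel f (Gs i)) \<inter> verts (relabel f G0) = set (map f (\<Omega> i))" if i: "i < q" for i
    using boundary[OF i] inj_on_image_Int[OF f subs[OF i] sub0] by simp
  have "relabel f G = UGraph (verts (relabel f G0) \<union> (\<Union>i<q. verts (relabel f (Gs i))))
      (edges (relabel f G0) \<union> (\<Union>i<q. edges (relabel f (Gs i))))"
    unfolding relabel_def G by (simp add: image_Un image_UN)
  then show ?thesis
    unfolding almost_embeddable_def
    using S simple_graph_relabel[OF G0(1) f0] emb q vortices' disj' boundary' disc' \<delta>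
    by (intro exI[of _ S] exI[of _ e] exI[of _ "relabel f G0"] exI[of _ \<phi>'] exI[of _ \<gamma>'] exI[of _ q]
        exI[of _ "\<lambda>i. relabel f (Gs i)"] exI[of _ "\<lambda>i. map f (\<Omega> i)"] exI[of _ \<delta>] conjI allI impI) auto
qed

lemma almost_embeddable_minor_nat:
  fixes G :: "'v ugraph"
  assumes "almost_embeddable g p k G" "is_minor H G" "finite (verts G)"
  shows "\<exists>G' :: nat ugraph. almost_embeddable g p k G' \<and> is_minor H G'"
proof -
  obtain f :: "'v \<Rightarrow> nat" where "inj_on f (verts G)"
    using finite_imp_inj_to_nat_seg[OF assms(3)] by blast
  then show ?thesis
    using almost_embeddable_relabel[OF assms(1)] is_minor_relabel[OF assms(2)] by blast
qed

section \<open>Complete minors\<close>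

text \<open>The branch sets of both constructions are naturally indexed by pairs; a bijection of the
  index set with \<open>{..<n}\<close> adapts them to \<open>complete_graph\<close>.\<close>

lemma is_minor_complete_graph:
  assumes "finite I" "card I = n"
    and conn: "\<And>x. x \<in> I \<Longrightarrow> connected_in G (B x)"
    and disj: "\<And>x y v. \<lbrakk>x \<in> I; y \<in> I; v \<in> B x; v \<in> B y\<rbrakk> \<Longrightarrow> x = y"
    and adj: "\<And>x y. \<lbrakk>x \<in> I; y \<in> I; x \<noteq> y\<rbrakk> \<Longrightarrow> \<exists>u v. u \<in> B x \<and> v \<in> B y \<and> {u, v} \<in> edges G"
  shows "is_minor (complete_graph n) G"
proof -
  obtain b where b: "bij_betw b {..<n} I"
    using ex_bij_betw_nat_finite[OF assms(1)] assms(2) by (auto simp: lessThan_atLeast0)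
  have bI: "b x \<in> I" if "x < n" for x
    using b that by (auto simp: bij_betw_def)
  have b_eq: "x = y" if "b x = b y" "x < n" "y < n" for x y
    using b that by (auto simp: bij_betw_def inj_on_def)
  show ?thesis
    unfolding is_minor_def
  proof (intro exI[of _ "\<lambda>x. B (b x)"] conjI ballI allI impI)
    fix x assume "x \<in> verts (complete_graph n)"
    then show "connected_in G (B (b x))"
      using conn bI by (simp add: complete_graph_def)
  next
    show "disjoint_family_on (\<lambda>x. B (b x)) (verts (complete_graph n))"
      unfolding disjoint_family_on_def complete_graph_def ugraph.sel
      using disj[OF bI bI] b_eq by blast
  next
    fix x y :: nat assume "{x, y} \<in> edges (complete_graph n)"
    then have "x < n" "y < n" "x \<noteq> y"
      unfolding complete_graph_def by auto
    then have "b x \<in> I" "b y \<in> I" "b x \<noteq> b y"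
      using bI b_eq by auto
    then show "\<exists>u\<in>B (b x). \<exists>v\<in>B (b y). {u, v} \<in> edges G"
      using adj by blast
  qed
qed

text \<open>Edges are unordered, so the adjacency relation is symmetric and two paths to the root
  \<open>z\<close> combine to a path between any two vertices.\<close>

lemma connected_in_root:
  assumes "z \<in> S" "S \<subseteq> verts G"
    and root: "\<And>x. x \<in> S \<Longrightarrow> (x, z) \<in> {(u, v). u \<in> S \<and> v \<in> S \<and> {u, v} \<in> edges G}\<^sup>*"
  shows "connected_in G S"
proof -
  let ?R = "{(u, v). u \<in> S \<and> v \<in> S \<and> {u, v} \<in> edges G}"
  have "sym ?R"
    by (auto simp: sym_def insert_commute)
  then have "sym (?R\<^sup>*)"
    by (rule sym_rtrancl)
  then have "(x, y) \<in> ?R\<^sup>*" if "x \<in> S" "y \<in> S" for x y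
    using root[OF that(1)] root[OF that(2)] by (meson rtrancl_trans symD)
  then show ?thesis
    unfolding connected_in_def using assms(1,2) by blast
qed

section \<open>Drawings given by tails and heads\<close>

text \<open>An edge is an unordered pair, but a drawing needs its first end as a function of the
  edge. The set \<open>T\<close> of tails, which contains one end of each edge, restores the
  direction.\<close>

definition tail_of :: "'v set \<Rightarrow> 'v set \<Rightarrow> 'v" where
  "tail_of T e = (THE u. u \<in> T \<and> u \<in> e)"

lemma tail_of_eq: "u \<in> T \<Longrightarrow> v \<notin> T \<Longrightarrow> tail_of T {u, v} = u"
  unfolding tail_of_def by (rule the_equality) auto

text \<open>Every tail has one outgoing edge and heads lie outside \<open>T\<close>, so edges
  correspond to tails and all conditions can be stated for tails. \<open>end_pos u\<close> is where
  the segment of \<open>u\<close> stops, at the head or at the point glued to it.\<close>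

lemma (in handles) drawing_of_arrows:
  fixes V T :: "'v set" and pos end_pos :: "'v \<Rightarrow> complex" and head :: "'v \<Rightarrow> 'v"
  assumes V: "finite V" "inj_on pos V" "\<And>u v. \<lbrakk>u \<in> V; v \<in> V\<rbrakk> \<Longrightarrow> \<not> twins (pos u) (pos v)"
      "\<And>v. v \<in> V \<Longrightarrow> pos v \<notin> holes"
    and T: "T \<subseteq> V" "\<And>u. u \<in> T \<Longrightarrow> head u \<in> V - T"
      "\<And>u. u \<in> T \<Longrightarrow> end_pos u = pos (head u) \<or> twins (pos (head u)) (end_pos u)"
    and segments: "\<And>u. u \<in> T \<Longrightarrow> pos u \<noteq> end_pos u"
      "\<And>u. u \<in> T \<Longrightarrow> closed_segment (pos u) (end_pos u) \<inter> closed_holes \<subseteq> {end_pos u}"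
      "\<And>u. u \<in> T \<Longrightarrow> end_pos u \<notin> holes"
      "\<And>u v w. \<lbrakk>u \<in> T; v \<in> T; w \<in> open_segment (pos u) (end_pos u);
        w \<in> open_segment (pos v) (end_pos v)\<rbrakk> \<Longrightarrow> u = v"
      "\<And>u v. \<lbrakk>u \<in> T; v \<in> V\<rbrakk> \<Longrightarrow> pos v \<notin> open_segment (pos u) (end_pos u)"
  shows "drawing h a r V pos ((\<lambda>u. {u, head u}) ` T)
    (\<lambda>e. pos (tail_of T e)) (\<lambda>e. end_pos (tail_of T e))"
proof -
  have tail: "tail_of T {u, head u} = u" if "u \<in> T" for u
    using T(2)[OF that] that by (intro tail_of_eq) auto
  show ?thesis
  proof unfold_locales
    fix e assume "e \<in> (\<lambda>u. {u, head u}) ` T"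
    then obtain u where u: "u \<in> T" "e = {u, head u}" "tail_of T e = u"
      using tail by auto
    have "u \<in> V" "head u \<in> V" "u \<noteq> head u"
      using T(1) T(2)[OF u(1)] u(1) by auto
    then show "\<exists>u\<in>V. \<exists>v\<in>V. u \<noteq> v \<and> e = {u, v} \<and> pos (tail_of T e) = pos u \<and>
        (end_pos (tail_of T e) = pos v \<or> twins (pos v) (end_pos (tail_of T e)))"
      unfolding u(3) using u(2) T(3)[OF u(1)] by blast
    show "pos (tail_of T e) \<noteq> end_pos (tail_of T e)"
      "closed_segment (pos (tail_of T e)) (end_pos (tail_of T e)) \<inter> closed_holes \<subseteq> {end_pos (tail_of T e)}"
      "end_pos (tail_of T e) \<notin> holes"
      unfolding u(3) using segments u(1) by simp_all
    show "open_segment (pos (tail_of T e)) (end_pos (tail_of T e)) \<inter> pos ` V = {}"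
      unfolding u(3) using segments(5)[OF u(1)] by blast
  next
    show "disjoint_family_on (\<lambda>e. open_segment (pos (tail_of T e)) (end_pos (tail_of T e)))
        ((\<lambda>u. {u, head u}) ` T)"
      unfolding disjoint_family_on_def using segments(4) by (auto simp: tail)
  qed (use V in auto)
qed

lemma horizontal_segment:
  assumes "Im p = Im q" "Re p < Re q"
  shows "w \<in> closed_segment p q \<Longrightarrow> Im w = Im p \<and> Re p \<le> Re w \<and> Re w \<le> Re q"
    and "w \<in> open_segment p q \<Longrightarrow> Im w = Im p \<and> Re p < Re w \<and> Re w < Re q"
proof -
  show *: "w \<in> closed_segment p q \<Longrightarrow> Im w = Im p \<and> Re p \<le> Re w \<and> Re w \<le> Re q" for w
    using assms by (auto simp: closed_segment_same_Im closed_segment_eq_real_ivl)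
  assume w: "w \<in> open_segment p q"
  then have "w \<noteq> p" "w \<noteq> q"
    by (auto simp: open_segment_def)
  moreover have "Im w = Im p \<and> Re p \<le> Re w \<and> Re w \<le> Re q"
    using *[OF subsetD[OF segment_open_subset_closed w]] .
  ultimately show "Im w = Im p \<and> Re p < Re w \<and> Re w < Re q"
    using assms unfolding complex_eq_iff by linarith
qed

lemma vertical_segment:
  assumes "Re p = Re q" "Im p < Im q"
  shows "w \<in> closed_segment p q \<Longrightarrow> Re w = Re p \<and> Im p \<le> Im w \<and> Im w \<le> Im q"
    and "w \<in> open_segment p q \<Longrightarrow> Re w = Re p \<and> Im p < Im w \<and> Im w < Im q"
proof -
  show *: "w \<in> closed_segment p q \<Longrightarrow> Re w = Re p \<and> Im p \<le> Im w \<and> Im w \<le> Im q" for w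
    using assms by (auto simp: closed_segment_same_Re closed_segment_eq_real_ivl)
  assume w: "w \<in> open_segment p q"
  then have "w \<noteq> p" "w \<noteq> q"
    by (auto simp: open_segment_def)
  moreover have "Re w = Re p \<and> Im p \<le> Im w \<and> Im w \<le> Im q"
    using *[OF subsetD[OF segment_open_subset_closed w]] .
  ultimately show "Re w = Re p \<and> Im p < Im w \<and> Im w < Im q"
    using assms unfolding complex_eq_iff by linarith
qed

section \<open>One vortex and a handle for every pair of its intervals\<close>

text \<open>For distinct \<open>i\<close> and \<open>j\<close>, \<open>Rim i j s s'\<close> is the
  boundary vertex in interval \<open>i\<close> from which hub \<open>s\<close> of \<open>i\<close>
  is joined towards hub \<open>s'\<close> of interval \<open>j\<close>. For \<open>i < j\<close>,
  its edge and that of \<open>Rim j i s' s\<close> meet in \<open>Gate i j s s'\<close> on the glued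
  circles.\<close>

datatype fan_vertex = Fan_Hub nat nat | Rim nat nat nat nat | Gate nat nat nat nat

text \<open>The rim vertices lie on the right half of a large circle and are divided into \<open>m\<close> intervals of \<open>m\<close> blocks.
  The block \<open>(i, j)\<close> faces a hole, which a handle joins to the hole that faces the block \<open>(j, i)\<close>.
  Horizontal segments from rim to hole thus realise all edges between the intervals \<open>i\<close> and \<open>j\<close>. As the gluing is a reflection,
  the shifts within the blocks \<open>(i, j)\<close> and \<open>(j, i)\<close> are opposite.\<close>

locale fan =
  fixes m k h :: nat and enum :: "nat \<Rightarrow> nat \<times> nat"
  assumes m_pos: "0 < m" and k_pos: "0 < k"
    and enum: "bij_betw enum {..<h} {(i, j). i < j \<and> j < m}"
begin

definition R :: real where "R = real (m * m) + 1"

definition block :: "nat \<Rightarrow> nat \<Rightarrow> real" where "block i j = real (i * m + j)"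

text \<open>\<open>prod_encode\<close> makes the offsets distinct. The 4 keeps them in (0, 1/4],
  below the radius 1/3 of the holes, so that a horizontal line at this offset from a centre cuts
  properly through the hole.\<close>

definition off :: "nat \<Rightarrow> nat \<Rightarrow> real" where "off s s' = 1 / (real (prod_encode (s, s')) + 4)"

definition shift :: "nat \<Rightarrow> nat \<Rightarrow> nat \<Rightarrow> nat \<Rightarrow> real" where
  "shift i j s s' = (if i \<le> j then off s s' else - off s' s)"

definition height :: "nat \<Rightarrow> nat \<Rightarrow> nat \<Rightarrow> nat \<Rightarrow> real" where
  "height i j s s' = block i j + shift i j s s'"

definition centre :: "nat \<Rightarrow> nat \<Rightarrow> complex" where
  "centre i j = Complex (R + 1) (block i j)"

definition pair :: "nat \<Rightarrow> nat \<times> nat" where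
  "pair l = (if even l then enum (l div 2) else prod.swap (enum (l div 2)))"

definition a :: "nat \<Rightarrow> complex" where "a l = centre (fst (pair l)) (snd (pair l))"

text \<open>Half the length of the chord that the horizontal line with this shift cuts out of a
  circle of radius 1/3. \<open>gate_pos\<close> is the end of the chord on the side of the
  rim.\<close>

definition depth :: "nat \<Rightarrow> nat \<Rightarrow> nat \<Rightarrow> nat \<Rightarrow> real" where
  "depth i j s s' = sqrt (1/9 - (shift i j s s')\<^sup>2)"

definition gate_pos :: "nat \<Rightarrow> nat \<Rightarrow> nat \<Rightarrow> nat \<Rightarrow> complex" where
  "gate_pos i j s s' = Complex (R + 1 - depth i j s s') (height i j s s')"

definition ang :: "fan_vertex \<Rightarrow> real" where
  "ang v = (case v of Rim i j s s' \<Rightarrow> arcsin (height i j s s' / R) | _ \<Rightarrow> 0)"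

definition pos :: "fan_vertex \<Rightarrow> complex" where
  "pos v = (case v of Rim i j s s' \<Rightarrow> Complex (sqrt (R\<^sup>2 - (height i j s s')\<^sup>2)) (height i j s s')
    | Gate i j s s' \<Rightarrow> gate_pos i j s s' | _ \<Rightarrow> 0)"

text \<open>For \<open>i > j\<close> this is not the position of the head
  \<open>Gate j i s' s\<close> but the point glued to it.\<close>

definition end_pos :: "fan_vertex \<Rightarrow> complex" where
  "end_pos v = (case v of Rim i j s s' \<Rightarrow> gate_pos i j s s' | _ \<Rightarrow> 0)"

definition head :: "fan_vertex \<Rightarrow> fan_vertex" where
  "head v = (case v of Rim i j s s' \<Rightarrow> if i < j then Gate i j s s' else Gate j i s' s | _ \<Rightarrow> v)"

definition rims :: "fan_vertex set" where
  "rims = {Rim i j s s' | i j s s'. i < m \<and> j < m \<and> s < k \<and> s' < k}"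

definition gates :: "fan_vertex set" where
  "gates = {Gate i j s s' | i j s s'. i < j \<and> j < m \<and> s < k \<and> s' < k}"

definition tails :: "fan_vertex set" where
  "tails = {Rim i j s s' | i j s s'. i < m \<and> j < m \<and> i \<noteq> j \<and> s < k \<and> s' < k}"

section \<open>Coordinates of blocks, heights and holes\<close>

lemma R_pos: "0 < R"
  unfolding R_def by (simp add: add_nonneg_pos)

lemma off_bounds: "0 < off s s'" "off s s' \<le> 1/4"
  unfolding off_def by (auto simp: field_simps)

lemma off_inj: "off s s' = off t t' \<Longrightarrow> s = t \<and> s' = t'"
  unfolding off_def by (simp add: prod_encode_eq)

lemma shift_bound: "\<bar>shift i j s s'\<bar> \<le> 1/4"
  using off_bounds[of s s'] off_bounds[of s' s] unfolding shift_def by auto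

lemma depth_sq: "(depth i j s s')\<^sup>2 = 1/9 - (shift i j s s')\<^sup>2"
  and depth_pos: "0 < depth i j s s'" and depth_le: "depth i j s s' \<le> 1/3"
proof -
  have "\<bar>shift i j s s'\<bar>\<^sup>2 \<le> (1/4)\<^sup>2"
    using shift_bound by (intro power_mono) auto
  then have *: "0 < 1/9 - (shift i j s s')\<^sup>2"
    by (simp add: power2_eq_square)
  then show "(depth i j s s')\<^sup>2 = 1/9 - (shift i j s s')\<^sup>2" "0 < depth i j s s'"
    unfolding depth_def by simp_all
  have "depth i j s s' \<le> sqrt ((1/3)\<^sup>2)"
    unfolding depth_def by (intro real_sqrt_le_mono) (simp add: power2_eq_square)
  then show "depth i j s s' \<le> 1/3" by simp
qed

lemma block_less: "i < i' \<Longrightarrow> j < m \<Longrightarrow> block i j + 1 \<le> block i' j'"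
proof -
  assume "i < i'" "j < m"
  then have "i * m + j + 1 \<le> Suc i * m" by simp
  moreover have "Suc i * m \<le> i' * m"
    using \<open>i < i'\<close> by (intro mult_le_mono1) simp
  ultimately have "i * m + j + 1 \<le> i' * m + j'" by linarith
  then show ?thesis unfolding block_def by linarith
qed

lemma block_dist:
  assumes "j < m" "j' < m" "(i, j) \<noteq> (i', j')"
  shows "1 \<le> \<bar>block i j - block i' j'\<bar>"
proof (cases "i = i'")
  case True
  then have "j \<noteq> j'" using assms by simp
  then show ?thesis unfolding block_def True by (cases "j < j'") auto
next
  case False
  then show ?thesis
    using block_less[of i i' j j'] block_less[of i' i j' j] assms by (cases "i < i'") auto
qed

lemma block_bounds: "i < m \<Longrightarrow> j < m \<Longrightarrow> 0 \<le> block i j \<and> block i j + 1 \<le> real (m * m)"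
  using block_less[of i m j 0] unfolding block_def by auto

lemma height_bound: "i < m \<Longrightarrow> j < m \<Longrightarrow> \<bar>height i j s s'\<bar> < R"
  using block_bounds[of i j] shift_bound[of i j s s'] unfolding height_def R_def by linarith

text \<open>A hole reaches 1/3 away from the level of its block and a shift is at most 1/4, which
  together stay below the distance 1 between different blocks. So a horizontal line from a rim
  vertex can only meet the hole facing its own block.\<close>

lemma height_block:
  assumes "j < m" "j' < m" "\<bar>height i j s s' - block i' j'\<bar> \<le> 1/3"
  shows "i = i' \<and> j = j'"
proof -
  have "\<bar>block i j - block i' j'\<bar> < 1"
    using assms(3) shift_bound[of i j s s'] unfolding height_def by linarith
  then show ?thesis
    using block_dist[OF assms(1,2), of i i'] by fastforce
qed

lemma height_inj:
  assumes "j < m" "j' < m" "height i j s s' = height i' j' t t'"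
  shows "i = i' \<and> j = j' \<and> s = t \<and> s' = t'"
proof -
  have "\<bar>block i j - block i' j'\<bar> < 1"
    using assms(3) shift_bound[of i j s s'] shift_bound[of i' j' t t'] unfolding height_def by linarith
  then have "i = i' \<and> j = j'"
    using block_dist[OF assms(1,2), of i i'] by fastforce
  then show ?thesis
    using assms(3) off_inj unfolding height_def shift_def by (auto split: if_splits)
qed

text \<open>Blocks are stacked interval by interval at distance at least 1, and shifts of at most
  1/4 cannot reverse their order. This gives the contiguity of the hub groups along the rim.\<close>

lemma height_mono:
  assumes "j < m" "j' < m" "height i j s s' < height i' j' t t'"
  shows "i \<le> i'"
  using block_less[of i' i j' j] assms shift_bound[of i j s s'] shift_bound[of i' j' t t']
  unfolding height_def by force

lemma pair_props:
  assumes "l < 2 * h"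
  shows "fst (pair l) < m" "snd (pair l) < m" "even l \<Longrightarrow> fst (pair l) < snd (pair l)"
    "odd l \<Longrightarrow> snd (pair l) < fst (pair l)"
proof -
  have "l div 2 < h"
    using assms by simp
  then have "enum (l div 2) \<in> {(i, j). i < j \<and> j < m}"
    using bspec[OF bij_betwE[OF enum], of "l div 2"] by simp
  then show "fst (pair l) < m" "snd (pair l) < m" "even l \<Longrightarrow> fst (pair l) < snd (pair l)"
    "odd l \<Longrightarrow> snd (pair l) < fst (pair l)"
    unfolding pair_def by auto
qed

lemma pair_inj:
  assumes "l < 2 * h" "l' < 2 * h" "pair l = pair l'"
  shows "l = l'"
proof -
  have parity: "even l \<longleftrightarrow> even l'"
    using pair_props[OF assms(1)] pair_props[OF assms(2)] assms(3) by (metis less_asym)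
  then have "enum (l div 2) = enum (l' div 2)"
    using assms(3) unfolding pair_def by (auto split: if_splits simp: prod_eq_iff)
  then have "l div 2 = l' div 2"
    using enum assms(1,2) unfolding bij_betw_def by (auto dest!: inj_onD)
  with parity show ?thesis by presburger
qed

lemma pair_surj:
  assumes "i < j" "j < m"
  obtains n where "n < h" "pair (2*n) = (i, j)" "pair (2*n+1) = (j, i)"
proof -
  have "(i, j) \<in> enum ` {..<h}"
    using enum assms unfolding bij_betw_def by auto
  then obtain n where "n < h" "enum n = (i, j)" by auto
  then show ?thesis
    using that[of n] unfolding pair_def by simp
qed

lemma cball_centre:
  assumes "w \<in> cball (centre i j) (1/3)"
  shows "\<bar>Im w - block i j\<bar> \<le> 1/3" "\<bar>Re w - (R + 1)\<bar> \<le> 1/3"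
proof -
  have "cmod (centre i j - w) \<le> 1/3"
    using assms by (simp add: dist_norm)
  then show "\<bar>Im w - block i j\<bar> \<le> 1/3" "\<bar>Re w - (R + 1)\<bar> \<le> 1/3"
    using abs_Im_le_cmod[of "centre i j - w"] abs_Re_le_cmod[of "centre i j - w"]
    unfolding centre_def minus_complex.sel complex.sel by linarith+
qed

sublocale handles h a "\<lambda>_. 1/3"
proof
  show "disjoint_family_on (\<lambda>l. cball (a l) (1/3)) {..<2 * h}"
    unfolding disjoint_family_on_def
  proof (intro ballI impI equals0I)
    fix l l' w assume l: "l \<in> {..<2*h}" "l' \<in> {..<2*h}" "l \<noteq> l'"
      and w: "w \<in> cball (a l) (1/3) \<inter> cball (a l') (1/3)"
    have "pair l \<noteq> pair l'"
      using pair_inj l by auto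
    then have "1 \<le> \<bar>block (fst (pair l)) (snd (pair l)) - block (fst (pair l')) (snd (pair l'))\<bar>"
      using block_dist pair_props(2) l by (auto simp: prod_eq_iff)
    moreover have "\<bar>Im w - block (fst (pair l)) (snd (pair l))\<bar> \<le> 1/3"
      "\<bar>Im w - block (fst (pair l')) (snd (pair l'))\<bar> \<le> 1/3"
      using w cball_centre(1) unfolding a_def by auto
    ultimately show False by linarith
  qed
qed auto

lemma closed_holesE:
  assumes "w \<in> closed_holes"
  obtains i j where "i < m" "j < m" "w \<in> cball (centre i j) (1/3)"
  using assms pair_props unfolding closed_holes_def a_def by blast

lemma gate_dist: "dist (centre i j) (gate_pos i j s s') = 1/3"
proof -
  have "(cmod (centre i j - gate_pos i j s s'))\<^sup>2 = (1/3)\<^sup>2"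
    unfolding cmod_power2 centre_def gate_pos_def height_def
    by (simp add: depth_sq) (simp add: power2_eq_square)
  then show ?thesis
    by (simp add: dist_norm power2_eq_iff_nonneg)
qed

lemma gate_not_in_holes:
  assumes "j < m"
  shows "gate_pos i j s s' \<notin> holes"
proof
  assume "gate_pos i j s s' \<in> holes"
  then obtain l where l: "l < 2 * h" "gate_pos i j s s' \<in> ball (a l) (1/3)"
    unfolding holes_def by auto
  then have "gate_pos i j s s' \<in> cball (centre (fst (pair l)) (snd (pair l))) (1/3)"
    unfolding a_def by auto
  then have "\<bar>height i j s s' - block (fst (pair l)) (snd (pair l))\<bar> \<le> 1/3"
    using cball_centre(1) unfolding gate_pos_def by fastforce
  then have "i = fst (pair l) \<and> j = snd (pair l)"
    using height_block assms pair_props(2)[OF l(1)] by blast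
  then show False
    using l(2) gate_dist[of i j s s'] unfolding a_def by auto
qed

text \<open>Relative to the centres, the gluing is complex conjugation: it keeps the horizontal
  offset \<open>- depth\<close> and negates the vertical one. Opposite shifts on the two sides
  therefore describe glued points.\<close>

lemma gates_twins:
  assumes "i < j" "j < m"
  shows "twins (gate_pos i j s s') (gate_pos j i s' s)"
proof -
  obtain n where n: "n < h" "pair (2*n) = (i, j)" "pair (2*n+1) = (j, i)"
    using pair_surj[OF assms] .
  have shift: "shift j i s' s = - shift i j s s'"
    using assms(1) unfolding shift_def by simp
  then have depth: "depth j i s' s = depth i j s s'"
    unfolding depth_def by simp
  have "gate_pos i j s s' \<in> sphere (a (2*n)) (1/3)"
    using gate_dist n(2) unfolding a_def by simp
  moreover have "gate_pos j i s' s = mirror (2*n) (2*n+1) (gate_pos i j s s')"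
    unfolding mirror_def a_def n(2,3) gate_pos_def centre_def height_def shift depth
    by (simp add: complex_eq_iff)
  ultimately show ?thesis
    unfolding twins_def using n(1) by blast
qed

lemma rim_norm:
  assumes "i < m" "j < m"
  shows "cmod (pos (Rim i j s s')) = R"
    and "pos (Rim i j s s') = of_real R * cis (ang (Rim i j s s'))"
proof -
  let ?y = "height i j s s'"
  have R: "\<bar>?y\<bar> < R"
    by (rule height_bound[OF assms])
  then have "0 < R" by linarith
  note R = this R
  then have "?y\<^sup>2 < R\<^sup>2"
    by (metis abs_ge_zero power2_abs power_strict_mono zero_less_numeral)
  then show "cmod (pos (Rim i j s s')) = R"
    unfolding pos_def using R by (simp add: cmod_def)
  have bound: "-1 \<le> ?y / R" "?y / R \<le> 1"
    using R by (auto simp: field_simps)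
  have "cos (arcsin (?y / R)) = sqrt ((R\<^sup>2 - ?y\<^sup>2) / R\<^sup>2)"
    using R bound by (simp add: cos_arcsin field_simps)
  also have "\<dots> = sqrt (R\<^sup>2 - ?y\<^sup>2) / R"
    using R by (simp add: real_sqrt_divide)
  finally show "pos (Rim i j s s') = of_real R * cis (ang (Rim i j s s'))"
    using R bound unfolding pos_def ang_def by (simp add: complex_eq_iff)
qed

lemma gate_Re: "R < Re (gate_pos i j s s')"
  using depth_le[of i j s s'] unfolding gate_pos_def by simp

lemma rim_Re:
  assumes "i < m" "j < m"
  shows "Re (pos (Rim i j s s')) \<le> R"
  using complex_Re_le_cmod[of "pos (Rim i j s s')"] rim_norm(1)[OF assms] by simp

lemma Im_pos: "Im (pos (Rim i j s s')) = height i j s s'" "Im (gate_pos i j s s') = height i j s s'"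
  unfolding pos_def gate_pos_def by simp_all

lemma disc_outside_holes: "cball 0 R \<inter> closed_holes = {}"
proof (intro equals0I)
  fix w assume w: "w \<in> cball 0 R \<inter> closed_holes"
  then obtain i j where "w \<in> cball (centre i j) (1/3)"
    using closed_holesE by blast
  then have "R < Re w"
    using cball_centre(2)[of w i j] by linarith
  then show False
    using w complex_Re_le_cmod[of w] by simp
qed

section \<open>The fan as a drawing in the plane with holes\<close>

lemma finite_vertices: "finite (rims \<union> gates)"
proof -
  have finite_index: "finite ({..<m} \<times> {..<m} \<times> {..<k} \<times> {..<k})"
    by simp
  have rims: "rims \<subseteq> (\<lambda>(i, j, s, s'). Rim i j s s') ` ({..<m} \<times> {..<m} \<times> {..<k} \<times> {..<k})"
    unfolding rims_def by force
  have gates: "gates \<subseteq> (\<lambda>(i, j, s, s'). Gate i j s s') ` ({..<m} \<times> {..<m} \<times> {..<k} \<times> {..<k})"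
  proof
    fix v assume "v \<in> gates"
    then obtain i j s s' where "v = Gate i j s s'" "i < j" "j < m" "s < k" "s' < k"
      unfolding gates_def by blast
    then show "v \<in> (\<lambda>(i, j, s, s'). Gate i j s s') ` ({..<m} \<times> {..<m} \<times> {..<k} \<times> {..<k})"
      using less_trans[of i j m] by (auto simp: image_iff)
  qed
  show ?thesis
    using finite_subset[OF rims finite_imageI[OF finite_index]]
      finite_subset[OF gates finite_imageI[OF finite_index]] by blast
qed

text \<open>On the right half of the circle, moving to the right increases the norm, so the segment
  leaves the vortex disc at once. At its height the facing hole begins at the near end of the chord,
  which is where the segment stops.\<close>

lemma tail_segment:
  assumes "u \<in> tails"
  shows "Im (pos u) = Im (end_pos u)" "Re (pos u) < Re (end_pos u)"
    "closed_segment (pos u) (end_pos u) \<inter> closed_holes \<subseteq> {end_pos u}"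
    "open_segment (pos u) (end_pos u) \<inter> cball 0 R = {}"
proof -
  obtain i j s s' where u: "u = Rim i j s s'" and ij: "i < m" "j < m" "i \<noteq> j"
    using assms unfolding tails_def by blast
  have e: "end_pos (Rim i j s s') = gate_pos i j s s'"
    unfolding end_pos_def by simp
  let ?y = "height i j s s'"
  show Im: "Im (pos u) = Im (end_pos u)"
    unfolding u e Im_pos ..
  show Re: "Re (pos u) < Re (end_pos u)"
    using rim_Re[OF ij(1,2), of s s'] gate_Re[of i j s s'] unfolding u e by linarith
  show "closed_segment (pos u) (end_pos u) \<inter> closed_holes \<subseteq> {end_pos u}"
  proof
    fix w assume "w \<in> closed_segment (pos u) (end_pos u) \<inter> closed_holes"
    then have w: "Im w = ?y" "Re w \<le> R + 1 - depth i j s s'" and "w \<in> closed_holes"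
      using horizontal_segment(1)[OF Im Re] unfolding u e Im_pos by (auto simp: gate_pos_def)
    then obtain i' j' where ij': "i' < m" "j' < m" "w \<in> cball (centre i' j') (1/3)"
      using closed_holesE by blast
    then have "i = i' \<and> j = j'"
      using height_block[OF ij(2) ij'(2), of i s s' i'] cball_centre(1)[OF ij'(3)] w(1) by simp
    then have "(cmod (centre i j - w))\<^sup>2 \<le> (1/3)\<^sup>2"
      using ij'(3) by (intro power_mono) (auto simp: dist_norm)
    moreover have "(cmod (centre i j - w))\<^sup>2 = (R + 1 - Re w)\<^sup>2 + (shift i j s s')\<^sup>2"
      unfolding cmod_power2 centre_def minus_complex.sel complex.sel w(1) height_def by simp
    ultimately have "(R + 1 - Re w)\<^sup>2 \<le> (depth i j s s')\<^sup>2"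
      unfolding depth_sq by (simp add: power_one_over)
    then have "R + 1 - Re w \<le> depth i j s s'"
      by (rule power2_le_imp_le) (rule less_imp_le[OF depth_pos])
    then show "w \<in> {end_pos u}"
      using w unfolding u e by (simp add: complex_eq_iff gate_pos_def)
  qed
  show "open_segment (pos u) (end_pos u) \<inter> cball 0 R = {}"
  proof (intro equals0I)
    fix w assume "w \<in> open_segment (pos u) (end_pos u) \<inter> cball 0 R"
    then have w: "Im w = ?y" "sqrt (R\<^sup>2 - ?y\<^sup>2) < Re w" "cmod w \<le> R"
      using horizontal_segment(2)[OF Im Re] unfolding u Im_pos by (auto simp: pos_def)
    have "R\<^sup>2 - ?y\<^sup>2 < (Re w)\<^sup>2"
      using w(2) real_le_rsqrt by (meson not_le)
    then have "R\<^sup>2 < (cmod w)\<^sup>2"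
      unfolding cmod_power2 w(1) by simp
    then show False
      using w(3) by (metis norm_ge_zero not_le power_mono)
  qed
qed

lemma vertex_cases:
  assumes "v \<in> rims \<union> gates"
  obtains (rim) i j s s' where "v = Rim i j s s'" "i < m" "j < m" "s < k" "s' < k"
    | (gate) i j s s' where "v = Gate i j s s'" "i < j" "i < m" "j < m" "s < k" "s' < k"
  using assms unfolding rims_def gates_def by (auto intro: less_trans)

lemma tail_cases:
  assumes "u \<in> tails"
  obtains i j s s' where "u = Rim i j s s'" "i < m" "j < m" "i \<noteq> j" "s < k" "s' < k"
    "end_pos u = gate_pos i j s s'"
  using assms unfolding tails_def by (auto simp: end_pos_def)

lemma pos_Gate: "pos (Gate i j s s') = gate_pos i j s s'"
  by (simp add: pos_def)

lemma rim_not_gate: "i < m \<Longrightarrow> j < m \<Longrightarrow> pos (Rim i j s s') \<noteq> gate_pos i' j' t t'"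
  using rim_Re[of i j s s'] gate_Re[of i' j' t t'] by force

lemma gate_pos_inj:
  assumes "j < m" "j' < m" "gate_pos i j s s' = gate_pos i' j' t t'"
  shows "i = i' \<and> j = j' \<and> s = t \<and> s' = t'"
  using height_inj[OF assms(1,2)] assms(3) Im_pos(2) by metis

lemma rim_pos_inj:
  assumes "j < m" "j' < m" "pos (Rim i j s s') = pos (Rim i' j' t t')"
  shows "i = i' \<and> j = j' \<and> s = t \<and> s' = t'"
  using height_inj[OF assms(1,2)] assms(3) Im_pos(1) by metis

lemma rim_not_in_closed_holes:
  assumes "i < m" "j < m"
  shows "pos (Rim i j s s') \<notin> closed_holes"
proof -
  have "pos (Rim i j s s') \<in> cball 0 R"
    using rim_norm(1)[OF assms] by simp
  then show ?thesis
    using disc_outside_holes by blast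
qed

lemma inj_on_pos: "inj_on pos (rims \<union> gates)"
proof (rule inj_onI)
  fix u v assume u: "u \<in> rims \<union> gates" and v: "v \<in> rims \<union> gates" and eq: "pos u = pos v"
  from u show "u = v"
  proof (cases rule: vertex_cases)
    case (rim i j s s')
    from v show ?thesis
    proof (cases rule: vertex_cases)
      case rim': (rim i' j' t t')
      show ?thesis using rim_pos_inj[of j j' i s s' i' t t'] rim rim' eq by simp
    next
      case (gate i' j' t t')
      then show ?thesis using rim_not_gate[of i j s s'] rim eq by (simp add: pos_Gate)
    qed
  next
    case gate: (gate i j s s')
    from v show ?thesis
    proof (cases rule: vertex_cases)
      case (rim i' j' t t')
      then show ?thesis using rim_not_gate[of i' j' t t'] gate eq by (metis pos_Gate)
    next
      case gate': (gate i' j' t t')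
      show ?thesis using gate_pos_inj[of j j' i s s' i' t t'] gate gate' eq by (simp add: pos_Gate)
    qed
  qed
qed

text \<open>Gates are vertices only for \<open>i < j\<close>, hence lie on circles of even index,
  while targets of the gluing lie on circles of odd index and rim vertices on none. So the gluing
  identifies no two vertices.\<close>

lemma no_twin_vertices:
  assumes "v \<in> rims \<union> gates"
  shows "\<not> twins w (pos v)"
proof
  assume tw: "twins w (pos v)"
  obtain n where n: "n < h" "pos v \<in> sphere (a (2*n+1)) (1/3)"
    using twins_sphere[OF tw] by blast
  from assms show False
  proof (cases rule: vertex_cases)
    case (rim i j s s')
    then show ?thesis
      using twins_closed_holes[OF tw] rim_not_in_closed_holes by auto
  next
    case (gate i j s s')
    let ?p = "pair (2*n+1)"
    have l: "2*n+1 < 2*h" using n(1) by simp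
    have "gate_pos i j s s' \<in> cball (centre (fst ?p) (snd ?p)) (1/3)"
      using n(2) unfolding gate(1) pos_Gate a_def by simp
    then have "\<bar>height i j s s' - block (fst ?p) (snd ?p)\<bar> \<le> 1/3"
      using cball_centre(1)[of "gate_pos i j s s'"] unfolding Im_pos by simp
    then have "i = fst ?p \<and> j = snd ?p"
      using height_block[OF gate(4) pair_props(2)[OF l]] by blast
    then show False
      using pair_props(4)[OF l] gate(2) by simp
  qed
qed

lemma drawing_fan:
  "drawing h a (\<lambda>_. 1/3) (rims \<union> gates) pos ((\<lambda>u. {u, head u}) ` tails)
    (\<lambda>e. pos (tail_of tails e)) (\<lambda>e. end_pos (tail_of tails e))"
proof (rule drawing_of_arrows)
  show "finite (rims \<union> gates)" "inj_on pos (rims \<union> gates)"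
    by (fact finite_vertices inj_on_pos)+
  show "\<not> twins (pos u) (pos v)" if "v \<in> rims \<union> gates" for u v
    using no_twin_vertices[OF that] .
  show "pos v \<notin> holes" if "v \<in> rims \<union> gates" for v
    using that
  proof (cases rule: vertex_cases)
    case (rim i j s s')
    then show ?thesis using rim_not_in_closed_holes holes_subset by auto
  next
    case (gate i j s s')
    then show ?thesis using gate_not_in_holes by (simp add: pos_Gate)
  qed
  show "tails \<subseteq> rims \<union> gates"
    unfolding tails_def rims_def by blast
next
  fix u assume u: "u \<in> tails"
  then obtain i j s s' where ij: "u = Rim i j s s'" "i < m" "j < m" "i \<noteq> j" "s < k" "s' < k"
    "end_pos u = gate_pos i j s s'"
    by (rule tail_cases)
  show "head u \<in> rims \<union> gates - tails"
    using ij unfolding head_def gates_def tails_def by auto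
  show "end_pos u = pos (head u) \<or> twins (pos (head u)) (end_pos u)"
  proof (cases "i < j")
    case True
    then show ?thesis using ij by (simp add: head_def pos_Gate)
  next
    case False
    then have "twins (gate_pos j i s' s) (gate_pos i j s s')"
      using gates_twins ij by simp
    then show ?thesis using False ij by (simp add: head_def pos_Gate)
  qed
  show "pos u \<noteq> end_pos u"
    using tail_segment(2)[OF u] by auto
  show "closed_segment (pos u) (end_pos u) \<inter> closed_holes \<subseteq> {end_pos u}"
    by (rule tail_segment(3)[OF u])
  show "end_pos u \<notin> holes"
    using gate_not_in_holes ij by simp
  fix v
  {
    fix w assume v: "v \<in> tails" and w: "w \<in> open_segment (pos u) (end_pos u)"
      "w \<in> open_segment (pos v) (end_pos v)"
    from v obtain i' j' t t' where ij': "v = Rim i' j' t t'" "j' < m"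
      by (rule tail_cases)
    \<comment> \<open>A point of a horizontal segment has the height of its tail, and by
      \<open>height_inj\<close> the height determines the rim vertex.\<close>
    have "Im (pos u) = Im (pos v)"
      using horizontal_segment(2)[OF tail_segment(1,2)[OF u] w(1)]
        horizontal_segment(2)[OF tail_segment(1,2)[OF v] w(2)] by simp
    then show "u = v"
      using height_inj[of j j' i s s' i' t t'] ij ij' by (simp add: Im_pos)
  }
  assume v: "v \<in> rims \<union> gates"
  \<comment> \<open>A vertex at the height of this segment carries the same four indices, so it
    could only be one of the two ends.\<close>
  show "pos v \<notin> open_segment (pos u) (end_pos u)"
  proof
    assume w: "pos v \<in> open_segment (pos u) (end_pos u)"
    then have "Im (pos v) = Im (pos u)"
      using horizontal_segment(2)[OF tail_segment(1,2)[OF u]] by blast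
    then have Im: "Im (pos v) = height i j s s'"
      using ij by (simp add: Im_pos)
    have ends: "pos v \<noteq> pos u" "pos v \<noteq> end_pos u"
      using w by (auto simp: open_segment_def)
    from v show False
    proof (cases rule: vertex_cases)
      case (rim i' j' t t')
      then show ?thesis using height_inj[of j' j i' t t' i s s'] Im ij ends by (simp add: Im_pos)
    next
      case (gate i' j' t t')
      then show ?thesis
        using height_inj[of j' j i' t t' i s s'] Im ij ends by (simp add: Im_pos pos_Gate)
    qed
  qed
qed

section \<open>Bags and hubs of the single vortex\<close>

definition grp :: "fan_vertex \<Rightarrow> nat" where
  "grp v = (case v of Rim i j s s' \<Rightarrow> i | _ \<Rightarrow> 0)"

text \<open>\<open>Fan_Hub\<close> does not record the vortex, but hub sets of different vortex
  indices must be disjoint; hence the empty sets for indices other than 0.\<close>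

definition hub :: "nat \<Rightarrow> nat \<Rightarrow> fan_vertex set" where
  "hub l i = (if l = 0 then Fan_Hub i ` {..<k} else {})"

definition spokes :: "fan_vertex set set" where
  "spokes = {{Rim i j s s', Fan_Hub i s} | i j s s'. i < m \<and> j < m \<and> s < k \<and> s' < k}
    \<union> {{Fan_Hub i s, Fan_Hub i s'} | i s s'. i < m \<and> s < k \<and> s' < k \<and> s \<noteq> s'}"

lemma spokes_in_bags:
  assumes "e \<in> spokes"
  shows "card e = 2 \<and> (\<exists>w\<in>rims. e \<subseteq> insert w (hub 0 (grp w)))"
  using assms unfolding spokes_def
proof (elim UnE)
  assume "e \<in> {{Rim i j s s', Fan_Hub i s} | i j s s'. i < m \<and> j < m \<and> s < k \<and> s' < k}"
  then obtain i j s s' where "e = {Rim i j s s', Fan_Hub i s}" "Rim i j s s' \<in> rims" "s < k"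
    unfolding rims_def by blast
  then show ?thesis
    by (intro conjI bexI[of _ "Rim i j s s'"]) (auto simp: hub_def grp_def)
next
  assume "e \<in> {{Fan_Hub i s, Fan_Hub i s'} | i s s'. i < m \<and> s < k \<and> s' < k \<and> s \<noteq> s'}"
  then obtain i s s' where "e = {Fan_Hub i s, Fan_Hub i s'}" "i < m" "s < k" "s' < k" "s \<noteq> s'"
    by blast
  \<comment> \<open>Every bag of interval \<open>i\<close> contains all hubs of \<open>i\<close>, so
    any rim vertex of the interval can serve as the witness.\<close>
  moreover from this have "Rim i 0 0 0 \<in> rims"
    using m_pos k_pos unfolding rims_def by blast
  ultimately show ?thesis
    by (intro conjI bexI[of _ "Rim i 0 0 0"]) (auto simp: hub_def grp_def)
qed

lemma rims_on_disc: "{v \<in> rims \<union> gates. pos v \<in> cball 0 R} = rims"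
proof (intro equalityI subsetI)
  fix v assume "v \<in> {v \<in> rims \<union> gates. pos v \<in> cball 0 R}"
  then have v: "v \<in> rims \<union> gates" "cmod (pos v) \<le> R" by auto
  from v(1) show "v \<in> rims"
  proof (cases rule: vertex_cases)
    case (rim i j s s')
    then show ?thesis unfolding rims_def by blast
  next
    case (gate i j s s')
    then show ?thesis
      using v(2) gate_Re[of i j s s'] complex_Re_le_cmod[of "gate_pos i j s s'"] by (simp add: pos_Gate)
  qed
next
  fix v assume v: "v \<in> rims"
  then obtain i j s s' where "v = Rim i j s s'" "i < m" "j < m"
    unfolding rims_def by blast
  then show "v \<in> {v \<in> rims \<union> gates. pos v \<in> cball 0 R}"
    using v rim_norm(1) by simp
qed

lemma layout_fan:
  "layout h a (\<lambda>_. 1/3) (rims \<union> gates) pos ((\<lambda>u. {u, head u}) ` tails)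
    (\<lambda>e. pos (tail_of tails e)) (\<lambda>e. end_pos (tail_of tails e))
    1 k (\<lambda>_. 0) (\<lambda>_. R) (\<lambda>_. rims) ang grp hub (\<lambda>_. spokes)"
proof (intro layout.intro layout_axioms.intro drawing_fan)
  fix e and i :: nat assume "e \<in> (\<lambda>u. {u, head u}) ` tails"
  then obtain u where u: "u \<in> tails" "e = {u, head u}" by blast
  have "head u \<notin> tails"
    using u(1) by (rule tail_cases) (auto simp: head_def tails_def)
  then have "tail_of tails e = u"
    unfolding u(2) using u(1) by (intro tail_of_eq)
  then show "open_segment (pos (tail_of tails e)) (end_pos (tail_of tails e)) \<inter> cball 0 R = {}"
    using tail_segment(4)[OF u(1)] by simp
next
  fix u v assume uv: "u \<in> rims" "v \<in> rims" "ang u < ang v"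
  then obtain i j s s' i' j' t t' where ij: "u = Rim i j s s'" "v = Rim i' j' t t'"
    "i < m" "j < m" "i' < m" "j' < m"
    unfolding rims_def by blast
  have R: "0 < R" by (rule R_pos)
  have "height i j s s' / R < height i' j' t t' / R"
  proof (rule ccontr)
    assume "\<not> ?thesis"
    then have "arcsin (height i' j' t t' / R) \<le> arcsin (height i j s s' / R)"
      using height_bound[OF ij(3,4), of s s'] height_bound[OF ij(5,6), of t t'] R
      by (intro arcsin_le_arcsin) (auto simp: field_simps)
    then show False
      using uv(3) ij by (simp add: ang_def)
  qed
  then have "height i j s s' < height i' j' t t'"
    using R by (simp add: divide_less_cancel)
  then show "grp u \<le> grp v"
    using height_mono ij by (simp add: grp_def)
next
  fix v assume "v \<in> rims"
  then obtain i j s s' where ij: "v = Rim i j s s'" "i < m" "j < m"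
    unfolding rims_def by blast
  then show "pos v = 0 + of_real R * cis (ang v)"
    using rim_norm(2) by simp
  have "\<bar>height i j s s'\<bar> < R"
    using height_bound ij by blast
  then have "-1 \<le> height i j s s' / R" "height i j s s' / R \<le> 1"
    by (auto simp: field_simps)
  then have "- (pi / 2) \<le> ang v" "ang v \<le> pi / 2"
    using arcsin_bounded[of "height i j s s' / R"] unfolding ij(1) ang_def by simp_all
  then show "- pi < ang v \<and> ang v \<le> pi"
    using pi_gt_zero by linarith
next
  show "rims \<noteq> {}"
    using m_pos k_pos unfolding rims_def by blast
  show "0 < R" by (rule R_pos)
  show "cball 0 R \<inter> closed_holes = {}" by (rule disc_outside_holes)
  show "{v \<in> rims \<union> gates. pos v \<in> cball 0 R} = rims" by (rule rims_on_disc)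
  show "card (hub l i) \<le> k" for l i
    unfolding hub_def using card_image_le[of "{..<k}" "Fan_Hub i"] by simp
  show "hub l i \<inter> (rims \<union> gates) = {}" for l i
    unfolding hub_def rims_def gates_def by auto
  show "v \<in> hub l i \<Longrightarrow> v \<in> hub l' i' \<Longrightarrow> l = l' \<and> i = i'" for v l i l' i'
    unfolding hub_def by (auto split: if_splits)
  show "l < 1 \<Longrightarrow> e \<in> spokes \<Longrightarrow> card e = 2 \<and> (\<exists>w\<in>rims. e \<subseteq> insert w (hub l (grp w)))" for l e
    using spokes_in_bags[of e] by simp
qed (auto simp: hub_def disjoint_family_on_def)

sublocale layout h a "\<lambda>_. 1/3" "rims \<union> gates" pos "(\<lambda>u. {u, head u}) ` tails"
    "\<lambda>e. pos (tail_of tails e)" "\<lambda>e. end_pos (tail_of tails e)"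
    1 k "\<lambda>_. 0" "\<lambda>_. R" "\<lambda>_. rims" ang grp hub "\<lambda>_. spokes"
  by (rule layout_fan)

section \<open>Branch sets of the fan\<close>

definition branch :: "nat \<times> nat \<Rightarrow> fan_vertex set" where
  "branch x = (case x of (i, s) \<Rightarrow> {Fan_Hub i s} \<union> {Rim i j s s' | j s'. j < m \<and> s' < k}
    \<union> {Gate i j s s' | j s'. i < j \<and> j < m \<and> s' < k})"

lemma fan_hub_in_graph:
  assumes "i < m" "s < k"
  shows "Fan_Hub i s \<in> verts layout_graph"
proof -
  have "Rim i 0 0 0 \<in> rims"
    using m_pos k_pos assms unfolding rims_def by blast
  moreover have "Fan_Hub i s \<in> hub 0 (grp (Rim i 0 0 0))"
    using assms by (simp add: hub_def grp_def)
  ultimately show ?thesis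
    unfolding layout_graph_def by auto
qed

lemma spoke_in_graph:
  "\<lbrakk>i < m; j < m; s < k; s' < k\<rbrakk> \<Longrightarrow> {Rim i j s s', Fan_Hub i s} \<in> edges layout_graph"
  unfolding layout_graph_def by (auto simp: spokes_def)

lemma hub_edge_in_graph:
  "\<lbrakk>i < m; s < k; s' < k; s \<noteq> s'\<rbrakk> \<Longrightarrow> {Fan_Hub i s, Fan_Hub i s'} \<in> edges layout_graph"
  unfolding layout_graph_def by (auto simp: spokes_def)

lemma gate_edge_in_graph:
  assumes "i < j" "j < m" "s < k" "s' < k"
  shows "{Rim i j s s', Gate i j s s'} \<in> edges layout_graph"
    and "{Gate i j s s', Rim j i s' s} \<in> edges layout_graph"
proof -
  have "Rim i j s s' \<in> tails" "Rim j i s' s \<in> tails"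
    using assms unfolding tails_def by auto
  then have "{u, head u} \<in> edges layout_graph" if "u \<in> {Rim i j s s', Rim j i s' s}" for u
    using that unfolding layout_graph_def by auto
  from this[of "Rim i j s s'"] this[of "Rim j i s' s"]
  show "{Rim i j s s', Gate i j s s'} \<in> edges layout_graph"
    "{Gate i j s s', Rim j i s' s} \<in> edges layout_graph"
    using assms(1) by (simp_all add: head_def insert_commute)
qed

lemma connected_branch:
  assumes "i < m" "s < k"
  shows "connected_in layout_graph (branch (i, s))"
proof (rule connected_in_root)
  show "Fan_Hub i s \<in> branch (i, s)"
    unfolding branch_def by simp
  have "rims \<union> gates \<subseteq> verts layout_graph"
    unfolding layout_graph_def by auto
  moreover have "branch (i, s) \<subseteq> insert (Fan_Hub i s) (rims \<union> gates)"
    using assms unfolding branch_def rims_def gates_def by auto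
  ultimately show "branch (i, s) \<subseteq> verts layout_graph"
    using fan_hub_in_graph[OF assms] by blast
next
  let ?E = "{(u, v). u \<in> branch (i, s) \<and> v \<in> branch (i, s) \<and> {u, v} \<in> edges layout_graph}"
  have rim: "(Rim i j s s', Fan_Hub i s) \<in> ?E" if "j < m" "s' < k" for j s'
    using spoke_in_graph[OF assms(1) that(1) assms(2) that(2)] that unfolding branch_def by auto
  have gate: "(Gate i j s s', Rim i j s s') \<in> ?E" if "i < j" "j < m" "s' < k" for j s'
    using gate_edge_in_graph(1)[OF that(1,2) assms(2) that(3)] that
    unfolding branch_def by (auto simp: insert_commute)
  fix x assume "x \<in> branch (i, s)"
  then consider "x = Fan_Hub i s" | j s' where "x = Rim i j s s'" "j < m" "s' < k"
    | j s' where "x = Gate i j s s'" "i < j" "j < m" "s' < k"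
    unfolding branch_def by auto
  then show "(x, Fan_Hub i s) \<in> ?E\<^sup>*"
  proof cases
    case 1
    then show ?thesis by simp
  next
    case (2 j s')
    then show ?thesis using rim by blast
  next
    case (3 j s')
    have "(x, Rim i j s s') \<in> ?E\<^sup>*"
      using gate[OF 3(2,3,4)] unfolding 3(1) by (rule r_into_rtrancl)
    then show ?thesis
      using rim[OF 3(3,4)] by (rule rtrancl_into_rtrancl)
  qed
qed

text \<open>A gate belongs to the branch set on the side of the smaller interval index, and its
  second edge, through the handle, ends in the branch set on the other side. Hubs of the same
  interval are adjacent directly.\<close>

lemma complete_minor_fan: "is_minor (complete_graph (m * k)) layout_graph"
proof (rule is_minor_complete_graph)
  show "finite ({..<m} \<times> {..<k})" "card ({..<m} \<times> {..<k}) = m * k"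
    by simp_all
  show "connected_in layout_graph (branch x)" if "x \<in> {..<m} \<times> {..<k}" for x
    using connected_branch that by auto
  show "x = y" if "v \<in> branch x" "v \<in> branch y" for x y v
    using that unfolding branch_def by (auto split: prod.splits)
  fix x y assume xy: "x \<in> {..<m} \<times> {..<k}" "y \<in> {..<m} \<times> {..<k}" "x \<noteq> y"
  obtain i s i' s' where x: "x = (i, s)" "i < m" "s < k" and y: "y = (i', s')" "i' < m" "s' < k"
    using xy by auto
  consider "i < i'" | "i' < i" | "i = i'" "s \<noteq> s'"
    using xy(3) x y by fastforce
  then show "\<exists>u v. u \<in> branch x \<and> v \<in> branch y \<and> {u, v} \<in> edges layout_graph"
  proof cases
    case 1
    then show ?thesis
      using gate_edge_in_graph(2)[OF 1 y(2) x(3) y(3)] x y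
      by (intro exI[of _ "Gate i i' s s'"] exI[of _ "Rim i' i s' s"]) (auto simp: branch_def)
  next
    case 2
    then show ?thesis
      using gate_edge_in_graph(2)[OF 2 x(2) y(3) x(3)] x y
      by (intro exI[of _ "Rim i i' s s'"] exI[of _ "Gate i' i s' s"])
        (auto simp: branch_def insert_commute)
  next
    case 3
    then show ?thesis
      using hub_edge_in_graph[OF x(2,3) y(3)] x y
      by (intro exI[of _ "Fan_Hub i s"] exI[of _ "Fan_Hub i s'"]) (auto simp: branch_def)
  qed
qed

lemma finite_layout_graph: "finite (verts layout_graph)"
proof -
  have "finite rims" "finite gates"
    using finite_vertices by auto
  then show ?thesis
    unfolding layout_graph_def by (simp add: hub_finite)
qed

end

lemma complete_minor_one_vortex:
  assumes "0 < m" "0 < k" "m * (m - 1) \<le> g" "1 \<le> p"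
  shows "\<exists>G :: nat ugraph. almost_embeddable g p k G \<and> is_minor (complete_graph (m * k)) G"
proof -
  define M where "M = {(i, j). i < j \<and> j < m}"
  have M: "M = (\<lambda>(j, i). (i, j)) ` (SIGMA j:{..<m}. {..<j})"
    unfolding M_def by auto
  have fin: "finite M"
    unfolding M by auto
  have "card M = card (SIGMA j:{..<m}. {..<j})"
    unfolding M by (rule card_image) (auto simp: inj_on_def)
  also have "\<dots> = \<Sum>{..<m}"
    by simp
  finally have "card M = m * (m - 1) div 2"
    using Sum_Ico_nat[of 0 m] by (simp add: lessThan_atLeast0)
  \<comment> \<open>Evenness makes the halving exact, so twice the number of handles is
    \<open>m * (m - 1)\<close>.\<close>
  moreover have "even (m * (m - 1))"
    by (cases m) auto
  ultimately have "2 * card M = m * (m - 1)"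
    by simp
  moreover obtain enum where "bij_betw enum {..<card M} M"
    using ex_bij_betw_nat_finite[OF fin] by (auto simp: lessThan_atLeast0)
  then interpret fan m k "card M" enum
    using assms(1,2) unfolding M_def by unfold_locales
  show ?thesis
    using almost_embeddable_minor_nat[OF almost_embeddable_layout complete_minor_fan finite_layout_graph]
      assms(3,4) calculation by simp
qed

section \<open>A planar grid of vortices\<close>

datatype direction = East | North | West | South

text \<open>\<open>Port d i j s\<close> is the boundary vertex at which strand \<open>s\<close>
  leaves the vortex of cell \<open>(i, j)\<close> in direction \<open>d\<close>. The first index
  counts columns and the second counts rows.\<close>

datatype grid_vertex = Grid_Hub nat nat nat | Port direction nat nat nat

text \<open>Around the centre of every cell of an \<open>L\<close> by \<open>L\<close> grid there is a vortex with \<open>2 * t\<close> hubs. The first \<open>t\<close>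
  hubs continue to the neighbours in the row, the others to the neighbours in the column.\<close>

locale grid =
  fixes L t k :: nat
  assumes L_pos: "0 < L" and t_pos: "0 < t" and hubs_le: "2 * t \<le> k"
begin

text \<open>The 7 keeps the angles below pi/6, hence the sines below 1/2 and the cosines above. In
  \<open>ang\<close> they are measured from the four axes so that facing ports of neighbouring cells
  share one coordinate, displaced by the same sine, and the strands between them are horizontal or
  vertical.\<close>

definition theta :: "nat \<Rightarrow> real" where "theta s = pi / (7 + real s)"

definition ang :: "grid_vertex \<Rightarrow> real" where
  "ang v = (case v of Port d i j s \<Rightarrow> (case d of East \<Rightarrow> theta s | North \<Rightarrow> pi/2 - theta s
     | West \<Rightarrow> pi - theta s | South \<Rightarrow> theta s - pi/2) | _ \<Rightarrow> 0)"

definition cell :: "nat \<Rightarrow> nat \<Rightarrow> complex" where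
  "cell i j = Complex (4 * real i) (4 * real j)"

definition pos :: "grid_vertex \<Rightarrow> complex" where
  "pos v = (case v of Port d i j s \<Rightarrow> cell i j + cis (ang v) | _ \<Rightarrow> 0)"

definition ports :: "grid_vertex set" where
  "ports = {Port d i j s | d i j s. i < L \<and> j < L \<and> s < t}"

definition cell_ports :: "nat \<Rightarrow> grid_vertex set" where
  "cell_ports c = {Port d (c div L) (c mod L) s | d s. s < t}"

definition tails :: "grid_vertex set" where
  "tails = {Port East i j s | i j s. Suc i < L \<and> j < L \<and> s < t}
    \<union> {Port North i j s | i j s. i < L \<and> Suc j < L \<and> s < t}"

definition head :: "grid_vertex \<Rightarrow> grid_vertex" where
  "head v = (case v of Port d i j s \<Rightarrow>
     (if d = East then Port West (Suc i) j s else Port South i (Suc j) s) | _ \<Rightarrow> v)"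

definition grid_hub :: "nat \<Rightarrow> nat \<Rightarrow> grid_vertex set" where
  "grid_hub c l = (if l = 0 then Grid_Hub (c div L) (c mod L) ` {..<2 * t} else {})"

definition port_hub :: "direction \<Rightarrow> nat \<Rightarrow> nat" where
  "port_hub d s = (if d = East \<or> d = West then s else t + s)"

definition spokes :: "nat \<Rightarrow> grid_vertex set set" where
  "spokes c = {{Port d (c div L) (c mod L) s, Grid_Hub (c div L) (c mod L) (port_hub d s)} | d s. s < t}
    \<union> {{Grid_Hub (c div L) (c mod L) x, Grid_Hub (c div L) (c mod L) y} | x y.
        x < 2 * t \<and> y < 2 * t \<and> x \<noteq> y}"

section \<open>Coordinates of the ports\<close>

lemma theta_bounds: "0 < theta s" "theta s < pi / 6"
proof -
  show "0 < theta s"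
    unfolding theta_def using pi_gt_zero by (intro divide_pos_pos) auto
  show "theta s < pi / 6"
    unfolding theta_def using pi_gt_zero by (intro divide_strict_left_mono) auto
qed

lemma sin_theta: "0 < sin (theta s)" "sin (theta s) < 1/2"
proof -
  show "0 < sin (theta s)"
    using theta_bounds[of s] pi_gt_zero by (intro sin_gt_zero) auto
  have "sin (theta s) < sin (pi / 6)"
    using theta_bounds[of s] pi_gt_zero by (subst sin_mono_less_eq) auto
  then show "sin (theta s) < 1/2"
    by (simp add: sin_30)
qed

lemma cos_theta: "1/2 < cos (theta s)"
proof -
  have "cos (pi / 3) < cos (theta s)"
    using theta_bounds[of s] pi_gt_zero by (subst cos_mono_less_eq) auto
  then show ?thesis
    by (simp add: cos_60)
qed

lemma cos_less_two: "cos (theta s) < 2"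
  using cos_le_one[of "theta s"] by (rule le_less_trans) simp

lemma sin_theta_inj:
  assumes "sin (theta s) = sin (theta s')"
  shows "s = s'"
proof -
  have "- (pi/2) \<le> theta x \<and> theta x \<le> pi/2" for x
    using theta_bounds[of x] pi_gt_zero by linarith
  then have "theta s = theta s'"
    using assms by (meson sin_inj_pi)
  then show ?thesis
    unfolding theta_def using pi_neq_zero by simp
qed

lemma pos_Port:
  "Re (pos (Port d i j s)) = 4 * real i + (case d of East \<Rightarrow> cos (theta s) | North \<Rightarrow> sin (theta s)
     | West \<Rightarrow> - cos (theta s) | South \<Rightarrow> sin (theta s))"
  "Im (pos (Port d i j s)) = 4 * real j + (case d of East \<Rightarrow> sin (theta s) | North \<Rightarrow> cos (theta s)
     | West \<Rightarrow> sin (theta s) | South \<Rightarrow> - cos (theta s))"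
  unfolding pos_def ang_def cell_def
  by (auto split: direction.split simp: cos_diff sin_diff)

lemma pos_cell: "pos (Port d i j s) \<in> cball (cell i j) 1"
  unfolding pos_def by (simp add: dist_norm)

lemma cball_cell:
  assumes "w \<in> cball (cell i j) 1"
  shows "\<bar>Re w - 4 * real i\<bar> \<le> 1" "\<bar>Im w - 4 * real j\<bar> \<le> 1"
    "(Re w - 4 * real i)\<^sup>2 + (Im w - 4 * real j)\<^sup>2 \<le> 1"
proof -
  have norm: "cmod (w - cell i j) \<le> 1"
    using assms by (simp add: dist_norm norm_minus_commute)
  then show "\<bar>Re w - 4 * real i\<bar> \<le> 1" "\<bar>Im w - 4 * real j\<bar> \<le> 1"
    using abs_Re_le_cmod[of "w - cell i j"] abs_Im_le_cmod[of "w - cell i j"]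
    unfolding cell_def minus_complex.sel complex.sel by linarith+
  have "(cmod (w - cell i j))\<^sup>2 \<le> 1"
    using norm by (simp add: power_le_one)
  then show "(Re w - 4 * real i)\<^sup>2 + (Im w - 4 * real j)\<^sup>2 \<le> 1"
    unfolding cmod_power2 cell_def by simp
qed

lemma near_multiples: "\<bar>x - 4 * real i\<bar> \<le> 1 \<Longrightarrow> \<bar>x - 4 * real j\<bar> \<le> 1 \<Longrightarrow> i = j"
  by linarith

lemma cell_unique:
  assumes "w \<in> cball (cell i j) 1" "w \<in> cball (cell i' j') 1"
  shows "i = i' \<and> j = j'"
  using cball_cell(1,2)[OF assms(1)] cball_cell(1,2)[OF assms(2)] near_multiples by blast

text \<open>The unit disc around a port determines its cell. Within a cell, the signs and the gap
  between sines below 1/2 and cosines above 1/2 reveal the direction, and the sine reveals the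
  strand.\<close>

lemma pos_inj:
  assumes "pos (Port d i j s) = pos (Port d' i' j' s')"
  shows "d = d' \<and> i = i' \<and> j = j' \<and> s = s'"
proof -
  have "i = i' \<and> j = j'"
    using cell_unique pos_cell assms by metis
  then show ?thesis
    using assms sin_theta[of s] sin_theta[of s'] cos_theta[of s] cos_theta[of s'] sin_theta_inj[of s s']
    unfolding complex_eq_iff pos_Port by (cases d; cases d') auto
qed

sublocale handles 0 "\<lambda>_. 0" "\<lambda>_. 1"
  by unfold_locales (auto simp: disjoint_family_on_def)

lemma no_holes: "holes = {}" "closed_holes = {}"
  unfolding holes_def closed_holes_def by auto

lemma tail_cases:
  assumes "u \<in> tails"
  obtains (east) i j s where "u = Port East i j s" "Suc i < L" "j < L" "s < t"
      "head u = Port West (Suc i) j s"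
    | (north) i j s where "u = Port North i j s" "i < L" "Suc j < L" "s < t"
      "head u = Port South i (Suc j) s"
  using assms unfolding tails_def by (auto simp: head_def)

lemma east_segment:
  "Re (pos (Port East i j s)) < Re (pos (Port West (Suc i) j s))"
  "w \<in> open_segment (pos (Port East i j s)) (pos (Port West (Suc i) j s)) \<Longrightarrow>
    Im w = 4 * real j + sin (theta s) \<and> 4 * real i + cos (theta s) < Re w \<and>
    Re w < 4 * real i + 4 - cos (theta s)"
proof -
  have *: "Im (pos (Port East i j s)) = Im (pos (Port West (Suc i) j s))"
    by (simp add: pos_Port)
  show **: "Re (pos (Port East i j s)) < Re (pos (Port West (Suc i) j s))"
    using cos_less_two[of s] by (simp add: pos_Port)
  assume "w \<in> open_segment (pos (Port East i j s)) (pos (Port West (Suc i) j s))"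
  from horizontal_segment(2)[OF * ** this]
  show "Im w = 4 * real j + sin (theta s) \<and> 4 * real i + cos (theta s) < Re w \<and>
    Re w < 4 * real i + 4 - cos (theta s)"
    by (simp add: pos_Port)
qed

lemma north_segment:
  "Im (pos (Port North i j s)) < Im (pos (Port South i (Suc j) s))"
  "w \<in> open_segment (pos (Port North i j s)) (pos (Port South i (Suc j) s)) \<Longrightarrow>
    Re w = 4 * real i + sin (theta s) \<and> 4 * real j + cos (theta s) < Im w \<and>
    Im w < 4 * real j + 4 - cos (theta s)"
proof -
  have *: "Re (pos (Port North i j s)) = Re (pos (Port South i (Suc j) s))"
    by (simp add: pos_Port)
  show **: "Im (pos (Port North i j s)) < Im (pos (Port South i (Suc j) s))"
    using cos_less_two[of s] by (simp add: pos_Port)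
  assume "w \<in> open_segment (pos (Port North i j s)) (pos (Port South i (Suc j) s))"
  from vertical_segment(2)[OF * ** this]
  show "Re w = 4 * real i + sin (theta s) \<and> 4 * real j + cos (theta s) < Im w \<and>
    Im w < 4 * real j + 4 - cos (theta s)"
    by (simp add: pos_Port)
qed

text \<open>A segment between consecutive cells stays outside the unit discs around their centres because
  its ends lie on the unit circles.\<close>

lemma gap_misses_discs:
  assumes "4 * real i + cos (theta s) < x" "x < 4 * real i + 4 - cos (theta s)"
    "\<bar>x - 4 * real i'\<bar> \<le> 1"
  shows "1 < (x - 4 * real i')\<^sup>2 + (sin (theta s))\<^sup>2"
proof -
  \<comment> \<open>Only the two cells at the ends of the gap can be within distance 1 of
    \<open>x\<close>, and \<open>x\<close> is farther from either centre than the port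
    there.\<close>
  have "cos (theta s) < \<bar>x - 4 * real i'\<bar>"
  proof -
    have "4 * real i < 4 * real i' + 1" "4 * real i' < 4 * real i + 5"
      using assms cos_theta[of s] by linarith+
    then have "i' = i \<or> i' = Suc i"
      by linarith
    then show ?thesis
      using assms by auto
  qed
  then have "(cos (theta s))\<^sup>2 < \<bar>x - 4 * real i'\<bar>\<^sup>2"
    using cos_theta[of s] by (intro power_strict_mono) auto
  then show ?thesis
    unfolding power2_abs using sin_cos_squared_add[of "theta s"] by linarith
qed

lemma same_multiple:
  "4 * real j + sin (theta s) = 4 * real j' + sin (theta s') \<Longrightarrow> j = j' \<and> s = s'"
proof -
  assume eq: "4 * real j + sin (theta s) = 4 * real j' + sin (theta s')"
  then have "j = j'"
    using sin_theta[of s] sin_theta[of s'] by linarith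
  then show ?thesis
    using eq sin_theta_inj by simp
qed

lemma near_sin_multiple: "\<bar>4 * real j + sin (theta s) - 4 * real j'\<bar> \<le> 1 \<Longrightarrow> j = j'"
  using sin_theta[of s] by linarith

text \<open>The coordinate across the segment, displaced by a sine below 1/2, forces the disc into
  the same row or column. There the coordinate along the segment is too far from the centre.\<close>

lemma segment_misses_discs:
  assumes "u \<in> tails"
  shows "open_segment (pos u) (pos (head u)) \<inter> cball (cell i' j') 1 = {}"
proof (intro equals0I)
  fix w assume "w \<in> open_segment (pos u) (pos (head u)) \<inter> cball (cell i' j') 1"
  then have w: "w \<in> open_segment (pos u) (pos (head u))" and disc: "w \<in> cball (cell i' j') 1"
    by auto
  note near = cball_cell[OF disc]
  from assms show False
  proof (cases rule: tail_cases)
    case (east i j s)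
    then have e: "Im w = 4 * real j + sin (theta s)" "4 * real i + cos (theta s) < Re w"
        "Re w < 4 * real i + 4 - cos (theta s)"
      using east_segment(2)[of w] w by auto
    then have "j = j'"
      using near(2) near_sin_multiple by simp
    then show False
      using gap_misses_discs[OF e(2,3) near(1)] near(3) e(1) by simp
  next
    case (north i j s)
    then have e: "Re w = 4 * real i + sin (theta s)" "4 * real j + cos (theta s) < Im w"
        "Im w < 4 * real j + 4 - cos (theta s)"
      using north_segment(2)[of w] w by auto
    then have "i = i'"
      using near(1) near_sin_multiple by simp
    then show False
      using gap_misses_discs[OF e(2,3) near(2)] near(3) e(1) by simp
  qed
qed

text \<open>Row strands run less than 1/2 above the centres of their row, whereas column strands
  outside the vortices stay more than 1/2 away from the levels of the centres. So rows and columns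
  cross only inside vortices.\<close>

lemma east_north_disjoint:
  assumes "w \<in> open_segment (pos (Port East i j s)) (pos (Port West (Suc i) j s))"
    "w \<in> open_segment (pos (Port North i' j' s')) (pos (Port South i' (Suc j') s'))"
  shows False
proof -
  have "4 * real j' + cos (theta s') < 4 * real j + sin (theta s)"
    "4 * real j + sin (theta s) < 4 * real j' + 4 - cos (theta s')"
    using east_segment(2)[OF assms(1)] north_segment(2)[OF assms(2)] by auto
  then have "j' < j" "j < j' + 1"
    using sin_theta[of s] cos_theta[of s'] by linarith+
  then show False by simp
qed

lemma segments_meet:
  assumes "u \<in> tails" "v \<in> tails" "w \<in> open_segment (pos u) (pos (head u))"
    "w \<in> open_segment (pos v) (pos (head v))"
  shows "u = v"
  using assms(1)
proof (cases rule: tail_cases)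
  case u: (east i j s)
  from assms(2) show ?thesis
  proof (cases rule: tail_cases)
    case v: (east i' j' s')
    have w: "Im w = 4 * real j + sin (theta s)" "4 * real i + cos (theta s) < Re w"
      "Re w < 4 * real i + 4 - cos (theta s)"
      "Im w = 4 * real j' + sin (theta s')" "4 * real i' + cos (theta s') < Re w"
      "Re w < 4 * real i' + 4 - cos (theta s')"
      using east_segment(2)[of w i j s] east_segment(2)[of w i' j' s'] assms(3,4) u v by auto
    have "i = i'"
      using w cos_theta[of s] cos_theta[of s'] by linarith
    then show ?thesis
      using same_multiple[of j s j' s'] w u v by simp
  next
    case v: (north i' j' s')
    show ?thesis
      using east_north_disjoint[of w i j s i' j' s'] assms(3,4) u v by simp
  qed
next
  case u: (north i j s)
  from assms(2) show ?thesis
  proof (cases rule: tail_cases)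
    case v: (east i' j' s')
    show ?thesis
      using east_north_disjoint[of w i' j' s' i j s] assms(3,4) u v by simp
  next
    case v: (north i' j' s')
    have w: "Re w = 4 * real i + sin (theta s)" "4 * real j + cos (theta s) < Im w"
      "Im w < 4 * real j + 4 - cos (theta s)"
      "Re w = 4 * real i' + sin (theta s')" "4 * real j' + cos (theta s') < Im w"
      "Im w < 4 * real j' + 4 - cos (theta s')"
      using north_segment(2)[of w i j s] north_segment(2)[of w i' j' s'] assms(3,4) u v by auto
    have "j = j'"
      using w cos_theta[of s] cos_theta[of s'] by linarith
    then show ?thesis
      using same_multiple[of i s i' s'] w u v by simp
  qed
qed

section \<open>The grid as a drawing in the plane\<close>

lemma finite_ports: "finite ports"
proof -
  have "finite ((\<lambda>(d, i, j, s). Port d i j s) ` ({East, North, West, South} \<times> {..<L} \<times> {..<L} \<times> {..<t}))"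
    by simp
  moreover have "v \<in> (\<lambda>(d, i, j, s). Port d i j s) ` ({East, North, West, South} \<times> {..<L} \<times> {..<L} \<times> {..<t})"
    if v: "v \<in> ports" for v
  proof -
    obtain d i j s where "v = Port d i j s" "i < L" "j < L" "s < t"
      using v unfolding ports_def by blast
    then show ?thesis
      by (cases d) (auto simp: image_iff)
  qed
  ultimately show ?thesis
    by (meson finite_subset subsetI)
qed

lemma head_ports: "u \<in> tails \<Longrightarrow> u \<in> ports \<and> head u \<in> ports - tails"
  unfolding tails_def ports_def head_def by auto

lemma drawing_grid:
  "drawing 0 (\<lambda>_. 0) (\<lambda>_. 1) ports pos ((\<lambda>u. {u, head u}) ` tails)
    (\<lambda>e. pos (tail_of tails e)) (\<lambda>e. pos (head (tail_of tails e)))"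
proof (rule drawing_of_arrows[where end_pos = "\<lambda>u. pos (head u)"])
  show "finite ports" by (rule finite_ports)
  show "inj_on pos ports"
    unfolding inj_on_def ports_def using pos_inj by blast
  show "\<not> twins u v" for u v
    using twins_closed_holes no_holes by blast
  show "tails \<subseteq> ports" "u \<in> tails \<Longrightarrow> head u \<in> ports - tails" for u
    using head_ports by blast+
  show "pos u \<noteq> pos (head u)" if "u \<in> tails" for u
    using that
  proof (cases rule: tail_cases)
    case (east i j s)
    then show ?thesis using pos_inj by fastforce
  next
    case (north i j s)
    then show ?thesis using pos_inj by fastforce
  qed
  show "u = v" if "u \<in> tails" "v \<in> tails" "w \<in> open_segment (pos u) (pos (head u))"
    "w \<in> open_segment (pos v) (pos (head v))" for u v w
    using segments_meet[OF that] .
  show "pos v \<notin> open_segment (pos u) (pos (head u))" if uv: "u \<in> tails" "v \<in> ports" for u v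
  proof -
    obtain d i j s where "v = Port d i j s"
      using uv unfolding ports_def by blast
    then show ?thesis
      using segment_misses_discs[OF uv(1), of i j] pos_cell by blast
  qed
qed (auto simp: no_holes)

lemma cell_ports_on_disc:
  assumes "c < L * L"
  shows "{v \<in> ports. pos v \<in> cball (cell (c div L) (c mod L)) 1} = cell_ports c"
proof -
  have "c div L < L" "c mod L < L"
    using assms L_pos by (simp_all add: less_mult_imp_div_less)
  then show ?thesis
    using pos_cell cell_unique unfolding ports_def cell_ports_def by blast
qed

lemma spokes_in_bags:
  assumes "e \<in> spokes c"
  shows "card e = 2 \<and> (\<exists>w\<in>cell_ports c. e \<subseteq> insert w (grid_hub c 0))"
  using assms unfolding spokes_def
proof (elim UnE)
  let ?i = "c div L" and ?j = "c mod L"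
  assume "e \<in> {{Port d ?i ?j s, Grid_Hub ?i ?j (port_hub d s)} | d s. s < t}"
  then obtain d s where "e = {Port d ?i ?j s, Grid_Hub ?i ?j (port_hub d s)}" "s < t"
    by blast
  then show ?thesis
    by (intro conjI bexI[of _ "Port d ?i ?j s"]) (auto simp: grid_hub_def cell_ports_def port_hub_def)
next
  let ?i = "c div L" and ?j = "c mod L"
  assume "e \<in> {{Grid_Hub ?i ?j x, Grid_Hub ?i ?j y} | x y. x < 2 * t \<and> y < 2 * t \<and> x \<noteq> y}"
  then obtain x y where "e = {Grid_Hub ?i ?j x, Grid_Hub ?i ?j y}" "x < 2 * t" "y < 2 * t" "x \<noteq> y"
    by blast
  then show ?thesis
    using t_pos by (intro conjI bexI[of _ "Port East ?i ?j 0"]) (auto simp: grid_hub_def cell_ports_def)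
qed

lemma ang_range: "- pi < ang (Port d i j s) \<and> ang (Port d i j s) \<le> pi"
  using theta_bounds[of s] unfolding ang_def by (cases d) auto

text \<open>The grouping is constant: each vortex has a single group of hubs, which lies in all of
  its bags. Vortex number \<open>c\<close> belongs to the cell
  \<open>(c div L, c mod L)\<close>.\<close>

lemma layout_grid:
  "layout 0 (\<lambda>_. 0) (\<lambda>_. 1) ports pos ((\<lambda>u. {u, head u}) ` tails)
    (\<lambda>e. pos (tail_of tails e)) (\<lambda>e. pos (head (tail_of tails e)))
    (L * L) k (\<lambda>c. cell (c div L) (c mod L)) (\<lambda>_. 1) cell_ports ang (\<lambda>_. 0) grid_hub spokes"
proof (intro layout.intro layout_axioms.intro drawing_grid)
  fix e c assume "e \<in> (\<lambda>u. {u, head u}) ` tails"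
  then obtain u where u: "u \<in> tails" "e = {u, head u}" by blast
  then have "tail_of tails e = u"
    using head_ports[of u] by (simp add: tail_of_eq)
  then show "open_segment (pos (tail_of tails e)) (pos (head (tail_of tails e))) \<inter>
      cball (cell (c div L) (c mod L)) 1 = {}"
    using segment_misses_discs[OF u(1)] by simp
next
  fix c v assume "v \<in> cell_ports c"
  then obtain d s where v: "v = Port d (c div L) (c mod L) s"
    unfolding cell_ports_def by blast
  show "pos v = cell (c div L) (c mod L) + of_real 1 * cis (ang v)"
    unfolding v pos_def by simp
  show "- pi < ang v \<and> ang v \<le> pi"
    unfolding v by (rule ang_range)
next
  show "disjoint_family_on (\<lambda>c. cball (cell (c div L) (c mod L)) 1) {..<L * L}"
    unfolding disjoint_family_on_def
  proof (intro ballI impI equals0I)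
    fix c c' w assume "c \<noteq> c'"
      "w \<in> cball (cell (c div L) (c mod L)) 1 \<inter> cball (cell (c' div L) (c' mod L)) 1"
    then show False
      using cell_unique by (metis IntE div_mult_mod_eq)
  qed
  show "cell_ports c \<noteq> {}" for c
    using t_pos unfolding cell_ports_def by blast
  show "{v \<in> ports. pos v \<in> cball (cell (c div L) (c mod L)) 1} = cell_ports c" if "c < L * L" for c
    by (rule cell_ports_on_disc[OF that])
  show "card (grid_hub c l) \<le> k" for c l
    using card_image_le[of "{..<2 * t}" "Grid_Hub (c div L) (c mod L)"] hubs_le
    unfolding grid_hub_def by simp
  show "grid_hub c l \<inter> ports = {}" for c l
    unfolding grid_hub_def ports_def by auto
  show "v \<in> grid_hub c l \<Longrightarrow> v \<in> grid_hub c' l' \<Longrightarrow> c = c' \<and> l = l'" for v c l c' l'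
    unfolding grid_hub_def by (auto split: if_splits) (metis div_mult_mod_eq)
  show "e \<in> spokes c \<Longrightarrow> card e = 2 \<and> (\<exists>w\<in>cell_ports c. e \<subseteq> insert w (grid_hub c 0))" for e c
    by (rule spokes_in_bags)
qed (auto simp: grid_hub_def no_holes)

sublocale layout 0 "\<lambda>_. 0" "\<lambda>_. 1" ports pos "(\<lambda>u. {u, head u}) ` tails"
    "\<lambda>e. pos (tail_of tails e)" "\<lambda>e. pos (head (tail_of tails e))"
    "L * L" k "\<lambda>c. cell (c div L) (c mod L)" "\<lambda>_. 1" cell_ports ang "\<lambda>_. 0" grid_hub spokes
  by (rule layout_grid)

section \<open>Branch sets of the grid\<close>

definition branch :: "nat \<times> nat \<Rightarrow> grid_vertex set" where
  "branch x = (case x of (i, s) \<Rightarrow>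
     (\<Union>l<L. {Grid_Hub l i s, Port East l i s, Port West l i s}) \<union>
     (\<Union>l<L. {Grid_Hub i l (t + s), Port North i l s, Port South i l s}))"

lemma cell_index:
  assumes "i < L" "j < L"
  obtains c where "c < L * L" "c div L = i" "c mod L = j"
proof
  have "i * L + j < Suc i * L" "Suc i * L \<le> L * L"
    using assms by (simp, intro mult_le_mono1) simp
  then show "i * L + j < L * L" by linarith
  show "(i * L + j) div L = i" "(i * L + j) mod L = j"
    using assms by simp_all
qed

lemma hub_in_graph:
  assumes "i < L" "j < L" "x < 2 * t"
  shows "Grid_Hub i j x \<in> verts layout_graph"
proof -
  obtain c where c: "c < L * L" "c div L = i" "c mod L = j"
    using cell_index[OF assms(1,2)] .
  then have "Grid_Hub i j x \<in> grid_hub c 0" "Port East i j 0 \<in> cell_ports c"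
    using assms(3) t_pos unfolding grid_hub_def cell_ports_def by auto
  then show ?thesis
    using c(1) unfolding layout_graph_def by auto
qed

lemma spoke_in_graph:
  assumes "i < L" "j < L" "s < t"
  shows "{Port d i j s, Grid_Hub i j (port_hub d s)} \<in> edges layout_graph"
proof -
  obtain c where c: "c < L * L" "c div L = i" "c mod L = j"
    using cell_index[OF assms(1,2)] .
  then have "{Port d i j s, Grid_Hub i j (port_hub d s)} \<in> spokes c"
    using assms(3) unfolding spokes_def by auto
  then show ?thesis
    using c(1) unfolding layout_graph_def by auto
qed

lemma hub_edge_in_graph:
  assumes "i < L" "j < L" "x < 2 * t" "y < 2 * t" "x \<noteq> y"
  shows "{Grid_Hub i j x, Grid_Hub i j y} \<in> edges layout_graph"
proof -
  obtain c where c: "c < L * L" "c div L = i" "c mod L = j"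
    using cell_index[OF assms(1,2)] .
  then have "{Grid_Hub i j x, Grid_Hub i j y} \<in> spokes c"
    using assms(3-5) unfolding spokes_def by auto
  then show ?thesis
    using c(1) unfolding layout_graph_def by auto
qed

lemma ports_in_graph: "ports \<subseteq> verts layout_graph"
  unfolding layout_graph_def by auto

lemma tail_edge_in_graph: "u \<in> tails \<Longrightarrow> {u, head u} \<in> edges layout_graph"
  unfolding layout_graph_def by auto

text \<open>Row \<open>i\<close> and column \<open>i\<close> share the diagonal vortex
  \<open>(i, i)\<close>, where the edge between hubs \<open>s\<close> and \<open>t + s\<close> joins
  the two strands. Its hub \<open>s\<close> is therefore the root.\<close>

lemma connected_branch:
  assumes i: "i < L" and s: "s < t"
  shows "connected_in layout_graph (branch (i, s))"
proof (rule connected_in_root)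
  let ?B = "branch (i, s)"
  let ?E = "{(u, v). u \<in> ?B \<and> v \<in> ?B \<and> {u, v} \<in> edges layout_graph}"
  show root: "Grid_Hub i i s \<in> ?B"
    unfolding branch_def using i by auto
  have "?B \<subseteq> {Grid_Hub i' j x | i' j x. i' < L \<and> j < L \<and> x < 2 * t} \<union> ports"
    unfolding branch_def ports_def using i s by auto
  then show "?B \<subseteq> verts layout_graph"
    using hub_in_graph ports_in_graph by (auto simp: subset_iff)
  have sym: "(u, v) \<in> ?E\<^sup>* \<Longrightarrow> (v, u) \<in> ?E\<^sup>*" for u v
  proof -
    have "sym ?E"
      by (auto simp: sym_def insert_commute)
    then show "(u, v) \<in> ?E\<^sup>* \<Longrightarrow> (v, u) \<in> ?E\<^sup>*"
      by (rule symD[OF sym_rtrancl])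
  qed
  have edge: "(u, v) \<in> ?E\<^sup>*" if "u \<in> ?B" "v \<in> ?B" "{u, v} \<in> edges layout_graph" for u v
    using that by (intro r_into_rtrancl) simp
  have row: "Grid_Hub l i s \<in> ?B" "Port East l i s \<in> ?B" "Port West l i s \<in> ?B"
    and col: "Grid_Hub i l (t + s) \<in> ?B" "Port North i l s \<in> ?B" "Port South i l s \<in> ?B" if "l < L" for l
    using that unfolding branch_def by auto
  have east: "(Port East l i s, Grid_Hub l i s) \<in> ?E\<^sup>*" and west: "(Port West l i s, Grid_Hub l i s) \<in> ?E\<^sup>*"
    if l: "l < L" for l
    using spoke_in_graph[OF l i s, of East] spoke_in_graph[OF l i s, of West] row[OF l]
    by (auto intro!: edge simp: port_hub_def)
  have north: "(Port North i l s, Grid_Hub i l (t + s)) \<in> ?E\<^sup>*"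
    and south: "(Port South i l s, Grid_Hub i l (t + s)) \<in> ?E\<^sup>*" if l: "l < L" for l
    using spoke_in_graph[OF i l s, of North] spoke_in_graph[OF i l s, of South] col[OF l]
    by (auto intro!: edge simp: port_hub_def)
  \<comment> \<open>Induction leads every hub of the row to cell 0; by symmetry the path from the
    root to cell 0 can then be reversed.\<close>
  have rows: "(Grid_Hub l i s, Grid_Hub 0 i s) \<in> ?E\<^sup>*" if "l < L" for l
    using that
  proof (induction l)
    case (Suc l)
    then have "Port East l i s \<in> tails"
      using i s unfolding tails_def by auto
    from tail_edge_in_graph[OF this]
    have "(Port East l i s, Port West (Suc l) i s) \<in> ?E\<^sup>*"
      using Suc.prems row[of l] row[of "Suc l"] by (auto intro!: edge simp: head_def)
    then have "(Port West (Suc l) i s, Port East l i s) \<in> ?E\<^sup>*"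
      by (rule sym)
    then show ?case
      using sym[OF west[of "Suc l"]] east[of l] Suc by (meson rtrancl_trans Suc_lessD)
  qed simp
  have cols: "(Grid_Hub i l (t + s), Grid_Hub i 0 (t + s)) \<in> ?E\<^sup>*" if "l < L" for l
    using that
  proof (induction l)
    case (Suc l)
    then have "Port North i l s \<in> tails"
      using i s unfolding tails_def by auto
    from tail_edge_in_graph[OF this]
    have "(Port North i l s, Port South i (Suc l) s) \<in> ?E\<^sup>*"
      using Suc.prems col[of l] col[of "Suc l"] by (auto intro!: edge simp: head_def)
    then have "(Port South i (Suc l) s, Port North i l s) \<in> ?E\<^sup>*"
      by (rule sym)
    then show ?case
      using sym[OF south[of "Suc l"]] north[of l] Suc by (meson rtrancl_trans Suc_lessD)
  qed simp
  have row_root: "(Grid_Hub l i s, Grid_Hub i i s) \<in> ?E\<^sup>*" if "l < L" for l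
    using rows[OF that] sym[OF rows[OF i]] by (rule rtrancl_trans)
  have "{Grid_Hub i i (t + s), Grid_Hub i i s} \<in> edges layout_graph"
    using i s by (intro hub_edge_in_graph) auto
  then have turn: "(Grid_Hub i i (t + s), Grid_Hub i i s) \<in> ?E\<^sup>*"
    using edge[OF col(1)[OF i] root] by blast
  have col_root: "(Grid_Hub i l (t + s), Grid_Hub i i s) \<in> ?E\<^sup>*" if "l < L" for l
    using rtrancl_trans[OF cols[OF that] sym[OF cols[OF i]]] turn by (rule rtrancl_trans)
  fix x assume "x \<in> ?B"
  then obtain l where l: "l < L" and "x \<in> {Grid_Hub l i s, Port East l i s, Port West l i s}
      \<union> {Grid_Hub i l (t + s), Port North i l s, Port South i l s}"
    unfolding branch_def by auto
  then consider "x = Grid_Hub l i s" | "x = Port East l i s" | "x = Port West l i s"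
    | "x = Grid_Hub i l (t + s)" | "x = Port North i l s" | "x = Port South i l s"
    by blast
  then show "(x, Grid_Hub i i s) \<in> ?E\<^sup>*"
    using row_root[OF l] col_root[OF l] rtrancl_trans[OF east[OF l] row_root[OF l]]
      rtrancl_trans[OF west[OF l] row_root[OF l]] rtrancl_trans[OF north[OF l] col_root[OF l]]
      rtrancl_trans[OF south[OF l] col_root[OF l]]
    by cases simp_all
qed

text \<open>Row \<open>i\<close> meets column \<open>i'\<close> in the vortex of cell
  \<open>(i', i)\<close>, whose hubs \<open>s\<close> and \<open>t + s'\<close> are adjacent. This
  also covers two strands with \<open>i = i'\<close>.\<close>

lemma complete_minor_grid: "is_minor (complete_graph (L * t)) layout_graph"
proof (rule is_minor_complete_graph)
  show "finite ({..<L} \<times> {..<t})" "card ({..<L} \<times> {..<t}) = L * t"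
    by simp_all
  show "connected_in layout_graph (branch x)" if "x \<in> {..<L} \<times> {..<t}" for x
    using connected_branch that by auto
  show "x = y" if "x \<in> {..<L} \<times> {..<t}" "y \<in> {..<L} \<times> {..<t}" "v \<in> branch x" "v \<in> branch y" for x y v
    using that unfolding branch_def by auto
  fix x y assume xy: "x \<in> {..<L} \<times> {..<t}" "y \<in> {..<L} \<times> {..<t}" "x \<noteq> y"
  obtain i s i' s' where x: "x = (i, s)" "i < L" "s < t" and y: "y = (i', s')" "i' < L" "s' < t"
    using xy by auto
  then show "\<exists>u v. u \<in> branch x \<and> v \<in> branch y \<and> {u, v} \<in> edges layout_graph"
    using hub_edge_in_graph[OF y(2) x(2), of s "t + s'"]
    by (intro exI[of _ "Grid_Hub i' i s"] exI[of _ "Grid_Hub i' i (t + s')"]) (auto simp: branch_def)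
qed

lemma finite_layout_graph: "finite (verts layout_graph)"
proof -
  have "cell_ports c \<subseteq> ports" if "c < L * L" for c
    using X_subset[OF that] .
  then have "finite (cell_ports c)" if "c < L * L" for c
    using that finite_ports finite_subset by blast
  then show ?thesis
    unfolding layout_graph_def using finite_ports by (simp add: hub_finite)
qed

end

lemma complete_minor_grid_of_vortices:
  assumes "0 < L" "0 < t" "2 * t \<le> k" "L * L \<le> p"
  shows "\<exists>G :: nat ugraph. almost_embeddable g p k G \<and> is_minor (complete_graph (L * t)) G"
proof -
  interpret grid L t k
    using assms by unfold_locales
  show ?thesis
    using almost_embeddable_minor_nat[OF almost_embeddable_layout complete_minor_grid finite_layout_graph]
      assms(4) by simp
qed

section \<open>Choice between the two constructions and the constant 1/4\<close>

lemma last_below: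
  fixes f :: "nat \<Rightarrow> nat"
  assumes "f 0 \<le> x" "\<exists>n. x < f n"
  obtains n where "f n \<le> x" "x < f (Suc n)"
proof -
  have least: "x < f (LEAST n. x < f n)"
    using assms(2) by (rule LeastI_ex)
  with assms(1) obtain n where n: "(LEAST n. x < f n) = Suc n"
    by (cases "LEAST n. x < f n") auto
  then have "f n \<le> x"
    using not_less_Least[of n "\<lambda>n. x < f n"] by simp
  with least n show ?thesis
    using that by simp
qed

theorem theorem16:
  fixes g p k :: nat
  assumes "p \<ge> 1" and "k \<ge> 2"
  shows "\<exists>n :: nat. real n \<ge> 1/4 * real k * sqrt (real (p + g)) \<and>
    (\<exists>G :: nat ugraph. almost_embeddable g p k G \<and> is_minor (complete_graph n) G)"
proof (cases "p \<le> 11 * g \<or> p + g \<le> 16")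
  \<comment> \<open>The fan has \<open>m * k\<close> branch sets, so
    \<open>p + g \<le> 16 * m\<^sup>2\<close> is needed. The factor 11 gives
    \<open>p + g \<le> 12 * g\<close> here and leaves \<open>g\<close> below \<open>p / 11\<close>
    in the other case. The bound 16 settles small values by \<open>1 \<le> m\<close> and forces
    \<open>4 \<le> L\<close> in the other case.\<close>
  case True
  obtain n where n: "Suc n * n \<le> g" "g < Suc (Suc n) * Suc n"
    by (rule last_below[of "\<lambda>n. Suc n * n" g]) (auto intro: exI[of _ "Suc g"])
  define m where "m = Suc n"
  have "p + g \<le> 16 * m\<^sup>2"
    using True
  proof
    assume "p \<le> 11 * g"
    moreover have "12 * g + 12 \<le> 12 * (m * m + m)"
      using n(2) by (simp add: m_def)
    \<comment> \<open>This amounts to \<open>12 * m \<le> 4 * m\<^sup>2 + 12\<close>, which follows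
      from the square of \<open>2 * m - 3\<close> being nonnegative. Integers are used since this
      difference may be negative.\<close>
    moreover have "12 * (m * m + m) \<le> 16 * (m * m) + 12"
    proof -
      have "0 \<le> (2 * int m - 3)\<^sup>2"
        by simp
      then have "12 * int m \<le> 4 * (int m * int m) + 12"
        by (simp add: power2_eq_square algebra_simps)
      then have "int (12 * m) \<le> int (4 * (m * m) + 12)"
        by simp
      then have "12 * m \<le> 4 * (m * m) + 12"
        by (simp only: of_nat_le_iff)
      then show ?thesis by simp
    qed
    ultimately show ?thesis
      unfolding power2_eq_square by linarith
  next
    assume "p + g \<le> 16"
    moreover have "1 \<le> m\<^sup>2"
      by (simp add: m_def)
    ultimately show ?thesis by linarith
  qed
  then have "real (p + g) \<le> real (16 * m\<^sup>2)"
    by (rule of_nat_mono)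
  then have "real (p + g) \<le> (4 * real m)\<^sup>2"
    by (simp add: power_mult_distrib)
  then have "sqrt (real (p + g)) \<le> 4 * real m"
    by (intro real_le_lsqrt) auto
  then have "1/4 * real k * sqrt (real (p + g)) \<le> 1/4 * real k * (4 * real m)"
    by (intro mult_left_mono) auto
  then have "1/4 * real k * sqrt (real (p + g)) \<le> real (m * k)"
    by (simp add: mult.commute)
  moreover have "0 < m" "0 < k" "m * (m - 1) \<le> g"
    using n(1) assms(2) by (simp_all add: m_def)
  ultimately show ?thesis
    using complete_minor_one_vortex[of m k g p] assms(1) by blast
next
  case False
  obtain L where L: "L * L \<le> p" "p < Suc L * Suc L"
    by (rule last_below[of "\<lambda>n. n * n" p]) (auto intro: exI[of _ "Suc p"])
  define t where "t = k div 2"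
  \<comment> \<open>Otherwise \<open>p \<le> 15\<close>, hence \<open>g \<le> 1\<close> by
    \<open>11 * g < p\<close>, contradicting \<open>p + g > 16\<close>.\<close>
  have "4 \<le> L"
  proof (rule ccontr)
    assume "\<not> 4 \<le> L"
    then have "Suc L * Suc L \<le> 4 * 4"
      by (intro mult_le_mono) auto
    then show False
      using L(2) False by linarith
  qed
  \<comment> \<open>In terms of \<open>s\<close>, \<open>2 * L\<close> is at most
    \<open>s / 2\<close>, so \<open>p\<close> is at most 3/2 of \<open>s\<close> and
    \<open>p + g\<close> at most 12/11 of that, which is below \<open>16 / 9 * s\<close>. The factor
    16/9 is the square of the 4/3 required when only \<open>k / 3\<close> strands are
    guaranteed.\<close>
  define s where "s = L\<^sup>2"
  have "4 * L \<le> s"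
    unfolding s_def power2_eq_square using \<open>4 \<le> L\<close> by (rule mult_le_mono1)
  moreover have "p \<le> s + 2 * L"
    unfolding s_def power2_eq_square using L(2) by simp
  moreover have "11 * g \<le> p"
    using False by linarith
  ultimately have "2 * p \<le> 3 * s" "99 * g \<le> 9 * p"
    by simp_all
  then have "9 * (p + g) \<le> 16 * s"
    by simp
  then have "real (9 * (p + g)) \<le> real (16 * s)"
    by (rule of_nat_mono)
  then have "real (p + g) \<le> (4/3 * real L)\<^sup>2"
    by (simp add: s_def power2_eq_square)
  then have "sqrt (real (p + g)) \<le> 4/3 * real L"
    by (intro real_le_lsqrt) auto
  then have "1/4 * real k * sqrt (real (p + g)) \<le> 1/4 * real k * (4/3 * real L)"
    by (intro mult_left_mono) auto
  also have "\<dots> = real L * (real k / 3)"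
    by simp
  \<comment> \<open>Rounding \<open>k div 2\<close> down loses most at \<open>k = 3\<close>, where
    equality holds.\<close>
  also have "k \<le> 3 * t"
    using assms(2) unfolding t_def by linarith
  then have "real L * (real k / 3) \<le> real L * real t"
    by (intro mult_left_mono) auto
  finally have "1/4 * real k * sqrt (real (p + g)) \<le> real (L * t)"
    by simp
  moreover have "0 < L" "0 < t" "2 * t \<le> k"
    using \<open>4 \<le> L\<close> assms(2) unfolding t_def by auto
  ultimately show ?thesis
    using complete_minor_grid_of_vortices[of L t k p g] L(1) by blast
qed

end
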